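(* Define integers $c(n)$ by $$\sum_{n=0}^{\infty}c(n)q^{n}=\frac{(q^{2};q^{2})_{\infty}}{(q;q)_{\infty}^{3}}.$$ Then for every integer $n\geq 0$, $$c(125n+99)\equiv 0 \pmod{25}.$$
   Context: Throughout, $|q|<1$ and $(a;q)_{\infty}=\prod_{n=0}^{\infty}(1-aq^{n})$. *)

theory Defs
  imports "HOL-Complex_Analysis.Complex_Analysis" "HOL-Number_Theory.Cong"
begin

definition qpoch :: "complex \<Rightarrow> complex \<Rightarrow> complex" where
  "qpoch a q = (\<Prod>n. 1 - a * q ^ n)"

text \<open>
  The remaining facts show that there is an integer sequence whose generating function is
  \<open>qpoch (q^2) (q^2) / qpoch q q ^ 3\<close> on the unit disc, so a hypothesis
  saying that \<open>c\<close> is such a sequence can be satisfied.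
\<close>

lemma norm_power_le_of_less_1:
  fixes q :: complex
  assumes "norm q \<le> r" "r < 1" "k \<ge> 1"
  shows "norm (q ^ k * (q ^ k) ^ n) \<le> r ^ n"
proof -
  have r0: "0 \<le> r" using assms(1) norm_ge_zero order_trans by blast
  have qk: "norm (q ^ k) \<le> r"
  proof -
    have "norm (q ^ k) \<le> r ^ k"
      using assms by (simp add: norm_power power_mono)
    also have "\<dots> \<le> r ^ 1"
      using assms r0 by (intro power_decreasing) auto
    finally show ?thesis by simp
  qed
  have "norm (q ^ k * (q ^ k) ^ n) = norm (q ^ k) * norm (q ^ k) ^ n"
    by (simp add: norm_mult norm_power)
  also have "\<dots> \<le> 1 * r ^ n"
    using qk assms(2) r0 by (intro mult_mono power_mono) auto
  finally show ?thesis by simp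
qed

lemma qpoch_convergent:
  fixes q :: complex
  assumes "norm q < 1" "k \<ge> 1"
  shows "convergent_prod (\<lambda>n. 1 - q ^ k * (q ^ k) ^ n)"
proof (rule abs_convergent_prod_imp_convergent_prod, rule summable_imp_abs_convergent_prod)
  show "summable (\<lambda>n. norm (1 - q ^ k * (q ^ k) ^ n - 1))"
  proof (rule summable_comparison_test)
    show "\<exists>N. \<forall>n\<ge>N. norm (norm (1 - q ^ k * (q ^ k) ^ n - 1)) \<le> norm q ^ n"
      using norm_power_le_of_less_1[of q "norm q" k] assms by auto
    show "summable (\<lambda>n. norm q ^ n)"
      using assms by (intro summable_geometric) auto
  qed
qed

lemma qpoch_nonzero:
  fixes q :: complex
  assumes "norm q < 1" "k \<ge> 1"
  shows "qpoch (q ^ k) (q ^ k) \<noteq> 0"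
  unfolding qpoch_def
proof (rule prodinf_nonzero[OF qpoch_convergent[OF assms]])
  fix n
  have "norm (q ^ k * (q ^ k) ^ n) = norm q ^ (k * Suc n)"
    by (simp add: norm_mult norm_power power_add flip: power_mult)
  also have "\<dots> < 1"
    using assms by (intro power_less_one_iff[THEN iffD2]) (auto simp: power_less_one_iff)
  finally show "1 - q ^ k * (q ^ k) ^ n \<noteq> 0"
    by auto
qed

lemma qpoch_uniform_limit:
  assumes "0 < r" "r < 1" "k \<ge> 1"
  shows "uniform_limit (cball 0 r) (\<lambda>N q. \<Prod>n<N. 1 - q ^ k * (q ^ k) ^ n)
           (\<lambda>q. qpoch (q ^ k) (q ^ k)) sequentially"
proof -
  have "uniformly_convergent_on (cball 0 r)
          (\<lambda>N q. \<Prod>n<N. 1 - q ^ k * (q ^ k) ^ n :: complex)"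
  proof (rule uniformly_convergent_on_prod')
    show "uniformly_convergent_on (cball 0 r)
            (\<lambda>N q. \<Sum>n<N. norm (1 - q ^ k * (q ^ k) ^ n - 1 :: complex))"
      by (rule Weierstrass_m_test'[where M = "\<lambda>n. r ^ n"])
         (use assms norm_power_le_of_less_1[of _ r k] in \<open>auto intro!: summable_geometric\<close>)
  qed (auto intro!: continuous_intros)
  then obtain l where l: "uniform_limit (cball 0 r)
      (\<lambda>N q. \<Prod>n<N. 1 - q ^ k * (q ^ k) ^ n :: complex) l sequentially"
    unfolding uniformly_convergent_on_def by blast
  have "l q = qpoch (q ^ k) (q ^ k)" if "q \<in> cball 0 r" for q
  proof (rule LIMSEQ_unique)
    show "(\<lambda>N. \<Prod>n<N. 1 - q ^ k * (q ^ k) ^ n) \<longlonglongrightarrow> l q"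
      using tendsto_uniform_limitI[OF l that] .
    show "(\<lambda>N. \<Prod>n<N. 1 - q ^ k * (q ^ k) ^ n) \<longlonglongrightarrow> qpoch (q ^ k) (q ^ k)"
      using convergent_prod_LIMSEQ[OF qpoch_convergent[of q k]] that assms
      by (auto simp: qpoch_def LIMSEQ_lessThan_iff_atMost)
  qed
  thus ?thesis
    using uniform_limit_cong'[THEN iffD1, OF _ _ l] by auto
qed

lemma qpoch_holomorphic:
  assumes "k \<ge> 1"
  shows "(\<lambda>q. qpoch (q ^ k) (q ^ k)) holomorphic_on ball 0 1"
proof (rule holomorphic_uniform_sequence[where f = "\<lambda>N q. \<Prod>n<N. 1 - q ^ k * (q ^ k) ^ n"])
  show "\<exists>d>0. cball x d \<subseteq> ball 0 1 \<and>
          uniform_limit (cball x d) (\<lambda>N q. \<Prod>n<N. 1 - q ^ k * (q ^ k) ^ n)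
            (\<lambda>q. qpoch (q ^ k) (q ^ k)) sequentially" if x: "x \<in> ball 0 1" for x :: complex
  proof -
    define r where "r = (norm x + 1) / 2"
    define d where "d = r - norm x"
    have r: "0 < r" "r < 1" and d: "d > 0"
      using x by (auto simp: r_def d_def field_simps add_pos_nonneg)
    have sub: "cball x d \<subseteq> cball 0 r"
      by (auto simp: d_def dist_norm)
         (smt (verit) norm_minus_commute norm_triangle_sub)
    moreover have "cball (0 :: complex) r \<subseteq> ball 0 1"
      using r by auto
    ultimately show ?thesis
      using d uniform_limit_on_subset[OF qpoch_uniform_limit[OF r assms] sub] by blast
  qed
qed (auto intro!: holomorphic_intros)

definition int_coeffs :: "complex fps \<Rightarrow> bool" where
  "int_coeffs F \<longleftrightarrow> (\<forall>n. fps_nth F n \<in> \<int>)"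

lemma int_coeffs_mult: "int_coeffs F \<Longrightarrow> int_coeffs G \<Longrightarrow> int_coeffs (F * G)"
  by (auto simp: int_coeffs_def fps_mult_nth intro!: Ints_sum Ints_mult)

lemma int_coeffs_1: "int_coeffs 1"
  by (auto simp: int_coeffs_def fps_one_nth)

lemma int_coeffs_X: "int_coeffs fps_X"
  by (auto simp: int_coeffs_def fps_X_def)

lemma int_coeffs_diff: "int_coeffs F \<Longrightarrow> int_coeffs G \<Longrightarrow> int_coeffs (F - G)"
  by (auto simp: int_coeffs_def)

lemma int_coeffs_prod: "(\<And>x. x \<in> A \<Longrightarrow> int_coeffs (F x)) \<Longrightarrow> int_coeffs (prod F A)"
  by (induction A rule: infinite_finite_induct) (auto simp: int_coeffs_1 int_coeffs_mult)

lemma int_coeffs_power: "int_coeffs F \<Longrightarrow> int_coeffs (F ^ n)"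
  by (induction n) (auto simp: int_coeffs_1 int_coeffs_mult)

lemma int_coeffs_inverse:
  assumes "int_coeffs F" "fps_nth F 0 = 1"
  shows "int_coeffs (inverse F)"
  unfolding int_coeffs_def
proof
  fix n show "fps_nth (inverse F) n \<in> \<int>"
  proof (induction n rule: less_induct)
    case (less n)
    show ?case
    proof (cases "n = 0")
      case True thus ?thesis using assms(2) by (simp add: fps_inverse_nth_0)
    next
      case False
      have "F * inverse F = 1"
        using assms(2) by (simp add: inverse_mult_eq_1')
      hence "(\<Sum>i=0..n. fps_nth F i * fps_nth (inverse F) (n - i)) = 0"
        using False by (metis fps_mult_nth fps_one_nth)
      hence "fps_nth (inverse F) n = - (\<Sum>i=1..n. fps_nth F i * fps_nth (inverse F) (n - i))"
        using assms(2) by (simp add: sum.atLeast_Suc_atMost eq_neg_iff_add_eq_0)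
      also have "\<dots> \<in> \<int>"
        using assms(1) less by (intro Ints_minus Ints_sum Ints_mult) (auto simp: int_coeffs_def)
      finally show ?thesis .
    qed
  qed
qed

lemma qpoch_fps:
  assumes "k \<ge> 1"
  obtains F where "(\<lambda>q. qpoch (q ^ k) (q ^ k)) has_fps_expansion F" "int_coeffs F" "fps_nth F 0 = 1"
proof -
  let ?g = "\<lambda>q. qpoch (q ^ k) (q ^ k)"
  let ?gN = "\<lambda>N q. \<Prod>n<N. 1 - q ^ k * (q ^ k) ^ n :: complex"
  define F where "F = fps_expansion ?g 0"
  have F: "?g has_fps_expansion F"
    unfolding F_def
    by (rule has_fps_expansion_fps_expansion[of "ball 0 1"]) (auto intro: qpoch_holomorphic assms)
  have int: "int_coeffs F"
    unfolding int_coeffs_def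
  proof
    fix m
    have "(\<lambda>N. (deriv ^^ m) (?gN N) 0 / fact m) \<longlonglongrightarrow> (deriv ^^ m) ?g 0 / fact m"
    proof (intro tendsto_intros higher_deriv_complex_uniform_limit)
      show "uniform_limit (ball 0 (1/2)) ?gN ?g sequentially"
        by (rule uniform_limit_on_subset[OF qpoch_uniform_limit[of "1/2"]]) (use assms in auto)
    qed (auto intro!: holomorphic_intros always_eventually)
    moreover have "(deriv ^^ m) (?gN N) 0 / fact m \<in> \<int>" for N
    proof -
      define P :: "complex fps" where "P = (\<Prod>n<N. 1 - fps_X ^ k * (fps_X ^ k) ^ n)"
      have P: "?gN N has_fps_expansion P"
        unfolding P_def
        by (intro has_fps_expansion_prod has_fps_expansion_diff has_fps_expansion_mult
                  has_fps_expansion_power has_fps_expansion_fps_X has_fps_expansion_1)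
      have "int_coeffs P"
        unfolding P_def
        by (intro int_coeffs_prod int_coeffs_diff int_coeffs_mult int_coeffs_power
                  int_coeffs_1 int_coeffs_X)
      hence "fps_nth P m \<in> \<int>"
        by (simp add: int_coeffs_def)
      thus ?thesis
        unfolding fps_nth_fps_expansion[OF P] .
    qed
    ultimately have "(deriv ^^ m) ?g 0 / fact m \<in> \<int>"
      by (rule closed_sequentially[OF closed_Ints, rotated])
    thus "fps_nth F m \<in> \<int>"
      using fps_nth_fps_expansion[OF F] by simp
  qed
  have "fps_nth F 0 = ?g 0"
    using fps_nth_fps_expansion[OF F, of 0] by simp
  also have "\<dots> = 1"
    using assms by (simp add: qpoch_def power_0_left)
  finally show ?thesis using that F int by blast
qed

lemma coefficients_exist:
  "\<exists>c :: nat \<Rightarrow> int. \<forall>q :: complex. norm q < 1 \<longrightarrow>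
     (\<lambda>n. of_int (c n) * q ^ n) sums (qpoch (q ^ 2) (q ^ 2) / qpoch q q ^ 3)"
proof -
  let ?f = "\<lambda>q. qpoch (q ^ 2) (q ^ 2) / qpoch q q ^ 3"
  obtain E where E: "(\<lambda>q. qpoch (q ^ 2) (q ^ 2)) has_fps_expansion E" "int_coeffs E"
    using qpoch_fps[of 2] by auto
  obtain D where D: "(\<lambda>q. qpoch q q) has_fps_expansion D" "int_coeffs D" "fps_nth D 0 = 1"
    using qpoch_fps[of 1] by auto
  have D0: "fps_nth (D ^ 3) 0 = 1"
    using D(3) by (simp add: fps_power_zeroth)
  have f: "?f has_fps_expansion E * inverse (D ^ 3)"
    unfolding divide_inverse using D0
    by (intro has_fps_expansion_mult has_fps_expansion_inverse has_fps_expansion_power E D) auto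
  have "int_coeffs (E * inverse (D ^ 3))"
    using D0 by (intro int_coeffs_mult int_coeffs_inverse int_coeffs_power E D)
  hence "\<forall>n. \<exists>m :: int. (deriv ^^ n) ?f 0 / fact n = of_int m"
    using fps_nth_fps_expansion[OF f] unfolding int_coeffs_def Ints_def by force
  then obtain c :: "nat \<Rightarrow> int" where c: "\<And>n. (deriv ^^ n) ?f 0 / fact n = of_int (c n)"
    by metis
  have "?f holomorphic_on ball 0 1"
    using qpoch_holomorphic[of 1] qpoch_holomorphic[of 2] qpoch_nonzero[of _ 1]
    by (intro holomorphic_intros) auto
  hence "(\<lambda>n. of_int (c n) * q ^ n) sums ?f q" if "norm q < 1" for q
    using holomorphic_power_series[of ?f 0 1 q] that c by simp
  thus ?thesis by blast
qed

end

theory Submission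
  imports Defs
begin

text \<open>
  Write \<open>E\<^sub>j\<close> for the Euler product in \<open>q\<^sup>j\<close> and \<open>U\<^sub>m\<close> for the operator \<open>\<Sum>a(n)q\<^sup>n \<mapsto> \<Sum>a(5n+m)q\<^sup>n\<close>.
  Since \<open>E\<^sub>j\<^sup>5 \<equiv> E\<^sub>5\<^sub>j (mod 5)\<close>, modulo 25 the section \<open>U\<^sub>m\<close> of an eta quotient is a combination of sections
  of quotients \<open>E\<^sub>1\<^sup>x E\<^sub>2\<^sup>y\<close> that are holomorphic modular forms of integral weight \<open>k\<close> on \<open>\<Gamma>\<^sub>0(2)\<close>.  For these, \<open>U\<^sub>m\<close> agrees modulo
  \<open>5\<^bsup>k-1\<^esup>\<close> with the Hecke operator \<open>T\<^sub>5\<close>, and the orders at the two cusps force the image to lie in a space of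
  dimension at most two, spanned by eta quotients.  This gives, with integers \<open>a, b, c, \<kappa>\<close> that need not
  be computed,
  \<open>U\<^sub>4(E\<^sub>2/E\<^sub>1\<^sup>3) \<equiv> 2a E\<^sub>2\<^bsup>13\<^esup>/E\<^sub>1\<^sup>7 - b E\<^sub>1\<^sup>9E\<^sub>2\<^sup>5 - c q E\<^sub>2\<^bsup>29\<^esup>/E\<^sub>1\<^bsup>15\<^esup>\<close> and \<open>U\<^sub>4U\<^sub>4(E\<^sub>2/E\<^sub>1\<^sup>3) \<equiv> \<kappa> E\<^sub>1\<^sup>5E\<^sub>2\<^sup>9 (mod 25)\<close>.
  Modulo 5 only the first term of the first congruence survives and \<open>U\<^sub>4\<close> kills it, so \<open>5 | \<kappa>\<close>; finally
  \<open>U\<^sub>3(E\<^sub>1\<^sup>5E\<^sub>2\<^sup>9) \<equiv> E\<^sub>1E\<^sub>2 U\<^sub>3(E\<^sub>2\<^sup>4) \<equiv> 0 (mod 5)\<close>.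

  The transformation law of the eta function comes from Liouville's theorem applied to a quotient of theta
  products, evaluated at the three half periods.
\<close>

section \<open>q-Pochhammer symbols\<close>

lemma qpoch_convergent':
  fixes a q :: complex
  assumes "norm q < 1"
  shows "convergent_prod (\<lambda>n. 1 - a * q ^ n)"
proof (rule abs_convergent_prod_imp_convergent_prod, rule summable_imp_abs_convergent_prod)
  have "summable (\<lambda>n. norm a * norm q ^ n)"
    using assms by (intro summable_mult summable_geometric) auto
  thus "summable (\<lambda>n. norm (1 - a * q ^ n - 1))"
    by (simp add: norm_mult norm_power)
qed

lemma qpoch_LIMSEQ:
  assumes "norm q < 1"
  shows "(\<lambda>N. \<Prod>n<N. 1 - a * q ^ n) \<longlonglongrightarrow> qpoch a q"
  using convergent_prod_LIMSEQ[OF qpoch_convergent'[OF assms, of a]]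
  by (simp add: qpoch_def LIMSEQ_lessThan_iff_atMost)

lemma qpoch_eqI:
  assumes "norm q < 1" "(\<lambda>N. \<Prod>n<N. 1 - a * q ^ n) \<longlonglongrightarrow> c"
  shows "qpoch a q = c"
  using LIMSEQ_unique[OF qpoch_LIMSEQ[OF assms(1)] assms(2)] .

lemma qpoch_head:
  assumes "norm q < 1"
  shows "qpoch a q = (1 - a) * qpoch (a * q) q"
proof (rule LIMSEQ_unique)
  show "(\<lambda>N. \<Prod>n<Suc N. 1 - a * q ^ n) \<longlonglongrightarrow> qpoch a q"
    using LIMSEQ_Suc[OF qpoch_LIMSEQ[OF assms]] .
  show "(\<lambda>N. \<Prod>n<Suc N. 1 - a * q ^ n) \<longlonglongrightarrow> (1 - a) * qpoch (a * q) q"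
    unfolding prod.lessThan_Suc_shift
    using tendsto_mult_left[OF qpoch_LIMSEQ[OF assms, of "a * q"], of "1 - a"]
    by (simp add: mult_ac)
qed

lemma qpoch_eq_0_iff:
  assumes "norm q < 1"
  shows "qpoch a q = 0 \<longleftrightarrow> (\<exists>n. a * q ^ n = 1)"
proof
  assume "\<exists>n. a * q ^ n = 1"
  then obtain n where n: "a * q ^ n = 1" by blast
  have "\<forall>\<^sub>F N in sequentially. (\<Prod>n<N. 1 - a * q ^ n) = 0"
    using eventually_gt_at_top[of n] by eventually_elim (use n in auto)
  hence "(\<lambda>N. \<Prod>n<N. 1 - a * q ^ n) \<longlonglongrightarrow> 0"
    by (rule tendsto_eventually)
  thus "qpoch a q = 0"
    by (rule qpoch_eqI[OF assms])
qed (use prodinf_nonzero[OF qpoch_convergent'[OF assms, of a]] in \<open>auto simp: qpoch_def\<close>)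

lemma qpoch_split:
  assumes "norm q < 1"
  shows "qpoch a q = qpoch a (q ^ 2) * qpoch (a * q) (q ^ 2)"
proof (rule LIMSEQ_unique)
  have q2: "norm (q ^ 2) < 1"
    using assms by (simp add: norm_power power_less_one_iff)
  show "(\<lambda>N. \<Prod>n<2 * N. 1 - a * q ^ n) \<longlonglongrightarrow> qpoch a q"
    by (rule LIMSEQ_subseq_LIMSEQ[OF qpoch_LIMSEQ[OF assms], unfolded o_def])
       (auto simp: strict_mono_def)
  have "(\<Prod>n<2 * N. 1 - a * q ^ n) =
        (\<Prod>n<N. 1 - a * (q ^ 2) ^ n) * (\<Prod>n<N. 1 - a * q * (q ^ 2) ^ n)" for N
    by (induction N) (simp_all add: power_mult mult_ac flip: power_mult)
  thus "(\<lambda>N. \<Prod>n<2 * N. 1 - a * q ^ n) \<longlonglongrightarrow> qpoch a (q ^ 2) * qpoch (a * q) (q ^ 2)"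
    by (simp add: tendsto_mult[OF qpoch_LIMSEQ qpoch_LIMSEQ] q2)
qed

lemma qpoch_mult_minus:
  assumes "norm q < 1"
  shows "qpoch a q * qpoch (-a) q = qpoch (a ^ 2) (q ^ 2)"
proof (rule LIMSEQ_unique)
  have q2: "norm (q ^ 2) < 1"
    using assms by (simp add: norm_power power_less_one_iff)
  show "(\<lambda>N. \<Prod>n<N. 1 - a ^ 2 * (q ^ 2) ^ n) \<longlonglongrightarrow> qpoch (a ^ 2) (q ^ 2)"
    by (rule qpoch_LIMSEQ[OF q2])
  have eq: "1 - a ^ 2 * (q ^ 2) ^ n = (1 - a * q ^ n) * (1 - (- a) * q ^ n)" for n
    by (simp add: power2_eq_square algebra_simps power_mult_distrib)
  have "(\<lambda>N. (\<Prod>n<N. 1 - a * q ^ n) * (\<Prod>n<N. 1 - (- a) * q ^ n)) \<longlonglongrightarrow> qpoch a q * qpoch (-a) q"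
    by (intro tendsto_mult qpoch_LIMSEQ assms)
  thus "(\<lambda>N. \<Prod>n<N. 1 - a ^ 2 * (q ^ 2) ^ n) \<longlonglongrightarrow> qpoch a q * qpoch (-a) q"
    unfolding eq prod.distrib .
qed

text \<open>Euler's identity (-q;q)(q;q^2) = 1 for q = r^2, with (q;q^2) factored further as
  (r;q)(-r;q). In this form it evaluates theta products at half periods.\<close>

lemma qpoch_euler:
  assumes "norm r < 1"
  shows "qpoch (- (r ^ 2)) (r ^ 2) * qpoch r (r ^ 2) * qpoch (- r) (r ^ 2) = 1"
proof -
  define q where "q = r ^ 2"
  have q: "norm q < 1" and q2: "norm (q ^ 2) < 1"
    using assms by (auto simp: q_def norm_power power_less_one_iff simp flip: power_mult)
  have "qpoch r q * qpoch (- r) q = qpoch q (q ^ 2)"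
    using qpoch_mult_minus[OF q, of r] by (simp add: q_def)
  moreover have "qpoch q q = qpoch q (q ^ 2) * qpoch (q ^ 2) (q ^ 2)"
    using qpoch_split[OF q, of q] by (simp add: power2_eq_square)
  moreover have "qpoch q q * qpoch (- q) q = qpoch (q ^ 2) (q ^ 2)"
    using qpoch_mult_minus[OF q, of q] .
  moreover have "qpoch (q ^ 2) (q ^ 2) \<noteq> 0"
    using qpoch_nonzero[of q 2] q by simp
  ultimately show ?thesis
    unfolding q_def[symmetric] by (metis mult.assoc mult.commute mult_cancel_left2 mult_eq_0_iff)
qed

text \<open>Here the base is fixed and only the first argument moves. Near any point the factors
  differ from 1 by at most a geometric sequence, so the partial products converge uniformly
  there.\<close>

lemma qpoch_holomorphic_base:
  assumes "norm q < 1"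
  shows "(\<lambda>a. qpoch a q) holomorphic_on UNIV"
proof (rule holomorphic_uniform_sequence[where f = "\<lambda>N a. \<Prod>n<N. 1 - a * q ^ n"])
  fix x :: complex
  define B where "B = norm x + 1"
  have B: "norm a \<le> B" if "a \<in> cball x 1" for a
    using that norm_triangle_sub[of a x] by (auto simp: B_def dist_norm norm_minus_commute)
  have "uniformly_convergent_on (cball x 1) (\<lambda>N a. \<Prod>n<N. 1 - a * q ^ n)"
  proof (rule uniformly_convergent_on_prod')
    show "uniformly_convergent_on (cball x 1) (\<lambda>N a. \<Sum>n<N. norm (1 - a * q ^ n - 1))"
    proof (rule Weierstrass_m_test'[where M = "\<lambda>n. B * norm q ^ n"])
      show "norm (norm (1 - a * q ^ n - 1)) \<le> B * norm q ^ n" if "a \<in> cball x 1" for n a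
        using B[OF that] by (auto simp: norm_mult norm_power intro!: mult_right_mono)
    qed (use assms in \<open>auto intro!: summable_mult summable_geometric\<close>)
  qed (auto intro!: continuous_intros)
  then obtain l where l: "uniform_limit (cball x 1) (\<lambda>N a. \<Prod>n<N. 1 - a * q ^ n) l sequentially"
    unfolding uniformly_convergent_on_def by blast
  have "l a = qpoch a q" if "a \<in> cball x 1" for a
    using qpoch_eqI[OF assms tendsto_uniform_limitI[OF l that]] by simp
  hence "uniform_limit (cball x 1) (\<lambda>N a. \<Prod>n<N. 1 - a * q ^ n) (\<lambda>a. qpoch a q) sequentially"
    using uniform_limit_cong'[THEN iffD1, OF _ _ l] by auto
  thus "\<exists>d>0. cball x d \<subseteq> UNIV \<and>
          uniform_limit (cball x d) (\<lambda>N a. \<Prod>n<N. 1 - a * q ^ n) (\<lambda>a. qpoch a q) sequentially"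
    by (intro exI[of _ 1]) auto
qed (auto intro!: holomorphic_intros)

lemma holomorphic_on_qpoch [holomorphic_intros]:
  assumes "norm q < 1" "f holomorphic_on A"
  shows "(\<lambda>z. qpoch (f z) q) holomorphic_on A"
  using holomorphic_on_compose_gen[OF assms(2) qpoch_holomorphic_base[OF assms(1)]]
  by (simp add: o_def)

section \<open>The exponential coordinate on the upper half-plane\<close>

definition qexp :: "complex \<Rightarrow> complex" where
  "qexp z = exp (2 * of_real pi * \<i> * z)"

lemma qexp_add: "qexp (a + b) = qexp a * qexp b"
  by (simp add: qexp_def ring_distribs exp_add)

lemma qexp_diff: "qexp (a - b) = qexp a / qexp b"
  by (simp add: qexp_def ring_distribs exp_diff)

lemma qexp_minus: "qexp (- a) = inverse (qexp a)"
  by (simp add: qexp_def exp_minus)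

lemma qexp_0 [simp]: "qexp 0 = 1"
  by (simp add: qexp_def)

lemma qexp_nonzero [simp]: "qexp z \<noteq> 0"
  by (simp add: qexp_def)

lemma qexp_of_nat_mult: "qexp (of_nat n * z) = qexp z ^ n"
  by (simp add: qexp_def mult_ac flip: exp_of_nat_mult)

lemma qexp_numeral_mult: "qexp (numeral n * z) = qexp z ^ numeral n"
  using qexp_of_nat_mult[of "numeral n" z] by simp

lemma qexp_eq_1_iff: "qexp z = 1 \<longleftrightarrow> z \<in> \<int>"
proof
  assume "qexp z = 1"
  then obtain n where "Re (2 * of_real pi * \<i> * z) = 0" "Im (2 * of_real pi * \<i> * z) = of_int (2 * n) * pi"
    unfolding qexp_def exp_eq_1 by blast
  hence "z = of_int n" by (auto simp: complex_eq_iff)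
  thus "z \<in> \<int>" by simp
next
  assume "z \<in> \<int>"
  then obtain n :: int where "z = of_int n" by (elim Ints_cases)
  thus "qexp z = 1"
    unfolding qexp_def exp_eq_1 by (auto intro!: exI[of _ n])
qed

lemma qexp_of_int [simp]: "qexp (of_int n) = 1"
  by (subst qexp_eq_1_iff) auto

lemma qexp_1 [simp]: "qexp 1 = 1"
  using qexp_of_int[of 1] by simp

lemma qexp_plus_1 [simp]: "qexp (z + 1) = qexp z"
  by (simp add: qexp_add)

lemma qexp_add_of_int [simp]: "qexp (z + of_int n) = qexp z"
  by (simp add: qexp_add)

lemma qexp_eqI: "a - b \<in> \<int> \<Longrightarrow> qexp a = qexp b"
  using qexp_eq_1_iff[of "a - b"] by (simp add: qexp_diff)

lemma qexp_half [simp]: "qexp (1 / 2) = -1"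
  by (simp add: qexp_def)

lemma norm_qexp: "norm (qexp z) = exp (- 2 * pi * Im z)"
  by (simp add: qexp_def)

lemma norm_qexp_less_1: "norm (qexp z) < 1 \<longleftrightarrow> Im z > 0"
  by (simp add: norm_qexp zero_less_mult_iff)

text \<open>The principal logarithm supplies the preimage; the bound on \<open>Re z\<close> later
  keeps |z| small on a horizontal segment.\<close>

lemma qexp_surj:
  assumes "w \<noteq> 0"
  obtains z where "w = qexp z" "\<bar>Re z\<bar> \<le> 1 / 2"
proof -
  define z where "z = Ln w / (2 * of_real pi * \<i>)"
  have "qexp z = w" using assms by (simp add: z_def qexp_def)
  have "Re z = Im (Ln w) / (2 * pi)"
    by (simp add: z_def Re_divide power2_eq_square)
  moreover have "\<bar>Im (Ln w)\<bar> \<le> pi"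
    using mpi_less_Im_Ln[OF assms] Im_Ln_le_pi[OF assms] by linarith
  ultimately have "\<bar>Re z\<bar> \<le> 1 / 2"
    by (simp add: abs_divide divide_le_eq)
  with \<open>qexp z = w\<close> show ?thesis using that by blast
qed

lemma holomorphic_on_qexp [holomorphic_intros]:
  "f holomorphic_on A \<Longrightarrow> (\<lambda>z. qexp (f z)) holomorphic_on A"
  unfolding qexp_def by (intro holomorphic_intros)

lemma Im_minus_inverse_pos: "Im z > 0 \<Longrightarrow> Im (- 1 / z) > 0"
  by (auto simp: Im_divide intro!: divide_pos_pos)
     (smt (verit) power2_eq_square sum_power2_gt_zero_iff)

section \<open>The transformation law of the eta function\<close>

definition lattice1 :: "complex \<Rightarrow> complex set" where
  "lattice1 \<tau> = {of_int m + of_int n * \<tau> | m n. True}"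

lemma lattice1_iff: "z \<in> lattice1 \<tau> \<longleftrightarrow> (\<exists>n. z - of_int n * \<tau> \<in> \<int>)"
proof
  assume "\<exists>n. z - of_int n * \<tau> \<in> \<int>"
  then obtain n m where "z - of_int n * \<tau> = of_int m" by (auto elim!: Ints_cases)
  hence "z = of_int m + of_int n * \<tau>" by (simp add: algebra_simps)
  thus "z \<in> lattice1 \<tau>" unfolding lattice1_def by blast
next
  assume "z \<in> lattice1 \<tau>"
  then obtain m n where "z = of_int m + of_int n * \<tau>" by (auto simp: lattice1_def)
  hence "z - of_int n * \<tau> = of_int m" by simp
  thus "\<exists>n. z - of_int n * \<tau> \<in> \<int>" by (metis Ints_of_int)
qed

lemma lattice1_0: "0 \<in> lattice1 \<tau>"
  by (auto simp: lattice1_iff intro!: exI[of _ 0])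

lemma lattice1_shift:
  assumes "w \<in> lattice1 \<tau>"
  shows "z + w \<in> lattice1 \<tau> \<longleftrightarrow> z \<in> lattice1 \<tau>"
proof -
  obtain m n where w: "w = of_int m + of_int n * \<tau>"
    using assms by (auto simp: lattice1_def)
  show ?thesis
  proof
    assume "z + w \<in> lattice1 \<tau>"
    then obtain m' n' where "z + w = of_int m' + of_int n' * \<tau>"
      by (auto simp: lattice1_def)
    hence "z = of_int (m' - m) + of_int (n' - n) * \<tau>"
      by (simp add: w algebra_simps)
    thus "z \<in> lattice1 \<tau>" unfolding lattice1_def by blast
  next
    assume "z \<in> lattice1 \<tau>"
    then obtain m' n' where "z = of_int m' + of_int n' * \<tau>"
      by (auto simp: lattice1_def)
    hence "z + w = of_int (m' + m) + of_int (n' + n) * \<tau>"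
      by (simp add: w algebra_simps)
    thus "z + w \<in> lattice1 \<tau>" unfolding lattice1_def by blast
  qed
qed

lemma half_notin_lattice1:
  assumes "Im \<tau> > 0"
  shows "1 / 2 \<notin> lattice1 \<tau>"
proof
  assume "1 / 2 \<in> lattice1 \<tau>"
  then obtain m n :: int where eq: "1 / 2 = of_int m + of_int n * \<tau>"
    by (auto simp: lattice1_def)
  from arg_cong[OF eq, of Im] assms have "n = 0" by simp
  with arg_cong[OF eq, of Re] have "1 = 2 * real_of_int m" by simp
  hence "1 = 2 * m" by linarith
  thus False by presburger
qed

text \<open>\<open>f / g\<close>, filled in by \<open>L\<close> at the zeros of \<open>g\<close>, is
  entire with periods 1 and \<tau>, hence bounded by its values on a compact parallelogram, and
  Liouville's theorem applies. Periodicity is assumed in cross-multiplied form to avoid dividing at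
  lattice points.\<close>

lemma elliptic_quotient_constant:
  assumes \<tau>: "Im \<tau> > 0"
  assumes f: "f holomorphic_on UNIV" and g: "g holomorphic_on UNIV"
  assumes g0: "\<And>z. g z = 0 \<longleftrightarrow> z \<in> lattice1 \<tau>"
  assumes per1: "\<And>z. f (z + 1) * g z = f z * g (z + 1)"
  assumes per\<tau>: "\<And>z. f (z + \<tau>) * g z = f z * g (z + \<tau>)"
  assumes lim: "((\<lambda>z. f z / g z) \<longlongrightarrow> L) (at 0)"
  assumes z: "z \<notin> lattice1 \<tau>"
  shows "f z = L * g z"
proof -
  define h where "h = (\<lambda>z. if z \<in> lattice1 \<tau> then L else f z / g z)"
  have in1: "1 \<in> lattice1 \<tau>" and int: "\<tau> \<in> lattice1 \<tau>"
    by (auto simp: lattice1_iff intro: exI[of _ 0] exI[of _ 1])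
  have h1: "h (z + 1) = h z" for z
    using per1[of z] g0[of z] g0[of "z + 1"] lattice1_shift[OF in1, of z]
    by (auto simp: h_def field_simps)
  have h\<tau>: "h (z + \<tau>) = h z" for z
    using per\<tau>[of z] g0[of z] g0[of "z + \<tau>"] lattice1_shift[OF int, of z]
    by (auto simp: h_def field_simps)
  have shift_int: "k (z + of_int n * w) = k z"
    if "\<And>z. k (z + w) = k z" for k :: "complex \<Rightarrow> complex" and z w n
  proof -
    have nat: "k (z + of_nat j * w) = k z" for j z
    proof (induction j)
      case (Suc j)
      have "k (z + of_nat (Suc j) * w) = k ((z + of_nat j * w) + w)"
        by (simp add: algebra_simps)
      also have "\<dots> = k z" using that Suc by simp
      finally show ?case .
    qed simp
    show ?thesis
    proof (cases "n \<ge> 0")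
      case True
      then obtain j where "n = int j" by (metis nonneg_int_cases)
      thus ?thesis using nat[of z j] by simp
    next
      case False
      define j where "j = nat (- n)"
      have j: "n = - int j" using False by (simp add: j_def)
      show ?thesis using nat[of "z + of_int n * w" j] by (simp add: j)
    qed
  qed
  have h_shift: "h (z + w) = h z" if w: "w \<in> lattice1 \<tau>" for z w
  proof -
    obtain m n where w: "w = of_int m + of_int n * \<tau>"
      using w by (auto simp: lattice1_def)
    have "h (z + w) = h ((z + of_int m * 1) + of_int n * \<tau>)"
      by (simp add: w algebra_simps)
    also have "\<dots> = h (z + of_int m * 1)"
      by (rule shift_int) (rule h\<tau>)
    also have "\<dots> = h z"
      by (rule shift_int) (rule h1)
    finally show ?thesis .
  qed
  have "lattice1 \<tau> = g -` {0}" using g0 by auto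
  hence closed: "closed (lattice1 \<tau>)"
    using holomorphic_on_imp_continuous_on[OF g] by (simp add: continuous_closed_vimage continuous_on_eq_continuous_at)
  have hol_off: "h holomorphic_on - lattice1 \<tau>"
  proof -
    have "(\<lambda>z. f z / g z) holomorphic_on - lattice1 \<tau>"
      using g0 by (intro holomorphic_intros holomorphic_on_subset[OF f] holomorphic_on_subset[OF g]) auto
    thus ?thesis by (rule holomorphic_transform) (auto simp: h_def)
  qed
  \<comment> \<open>The point 1/2 witnesses that \<open>g\<close> is not identically zero, so its
    zero at 0 is isolated.\<close>
  have "g 0 = 0" and "g (1 / 2) \<noteq> 0"
    using g0 half_notin_lattice1[OF \<tau>] lattice1_0 by auto
  then obtain r where r: "r > 0" "\<And>z. z \<in> ball 0 r - {0} \<Longrightarrow> g z \<noteq> 0"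
    using isolated_zeros[OF g open_UNIV connected_UNIV, of 0 "1/2"] by (metis UNIV_I)
  have hol0: "h holomorphic_on ball 0 r"
  proof (rule no_isolated_singularity'[where K = "{0}"])
    show "h holomorphic_on ball 0 r - {0}"
      by (rule holomorphic_on_subset[OF hol_off]) (use r(2) g0 in auto)
    have "((\<lambda>z. f z / g z) \<longlongrightarrow> h 0) (at 0)"
      using lim lattice1_0 by (simp add: h_def)
    hence "(h \<longlongrightarrow> h 0) (at 0)"
    proof (rule Lim_transform_within_open)
      show "open (ball 0 r)" "0 \<in> ball (0::complex) r" using r by auto
      show "f x / g x = h x" if "x \<in> ball 0 r" "x \<noteq> 0" for x
        using r(2)[of x] that g0 by (auto simp: h_def)
    qed
    thus "(h \<longlongrightarrow> h z) (at z within ball 0 r)" if "z \<in> {0}" for z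
      using that by (auto intro: tendsto_within_subset)
  qed auto
  have "h field_differentiable at w" for w
  proof (cases "w \<in> lattice1 \<tau>")
    case False
    thus ?thesis
      using hol_off closed by (auto intro: holomorphic_on_imp_differentiable_at)
  next
    case True
    \<comment> \<open>Periodicity transports holomorphy at 0 to every other lattice point.\<close>
    have "h \<circ> (\<lambda>z. z - w) holomorphic_on ball w r"
      by (rule holomorphic_on_compose_gen[OF _ hol0])
         (auto simp: dist_norm norm_minus_commute intro!: holomorphic_intros)
    hence "h holomorphic_on ball w r"
      by (rule holomorphic_transform) (use h_shift[OF True, of "_ - w"] in \<open>auto simp: o_def\<close>)
    thus ?thesis
      using r by (auto intro: holomorphic_on_imp_differentiable_at)
  qed
  hence hol: "h holomorphic_on UNIV"
    by (simp add: holomorphic_on_def)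
  \<comment> \<open>Replacing the real coordinates with respect to 1 and \<tau> by their fractional
    parts moves any point into the closed period parallelogram.\<close>
  have "range h \<subseteq> h ` ((\<lambda>(a, b). of_real a + of_real b * \<tau>) ` (cbox 0 1 \<times> cbox 0 (1::real)))"
  proof safe
    fix w
    define b where "b = Im w / Im \<tau>"
    define a where "a = Re w - b * Re \<tau>"
    have w: "w = of_real a + of_real b * \<tau>"
      using \<tau> by (simp add: a_def b_def complex_eq_iff)
    define u where "u = of_real (frac a) + of_real (frac b) * \<tau>"
    have "w = u + (of_int \<lfloor>a\<rfloor> + of_int \<lfloor>b\<rfloor> * \<tau>)"
      by (simp add: w u_def frac_def algebra_simps)
    hence hu: "h w = h u"
      using h_shift[of "of_int \<lfloor>a\<rfloor> + of_int \<lfloor>b\<rfloor> * \<tau>" u] by (auto simp: lattice1_def)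
    have "(frac a, frac b) \<in> cbox 0 1 \<times> cbox 0 1"
      using frac_lt_1[of a] frac_lt_1[of b] by auto
    hence "u \<in> (\<lambda>(a, b). of_real a + of_real b * \<tau>) ` (cbox 0 1 \<times> cbox 0 1)"
      unfolding u_def by (rule rev_image_eqI) simp
    with hu show "h w \<in> h ` ((\<lambda>(a, b). of_real a + of_real b * \<tau>) ` (cbox 0 1 \<times> cbox 0 1))"
      by simp
  qed
  moreover have "compact (h ` ((\<lambda>(a, b). of_real a + of_real b * \<tau>) ` (cbox 0 1 \<times> cbox 0 (1::real))))"
    by (intro compact_continuous_image compact_Times compact_cbox)
       (auto simp: case_prod_unfold intro!: continuous_intros continuous_on_subset[OF holomorphic_on_imp_continuous_on[OF hol]])
  ultimately have "bounded (range h)"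
    using compact_imp_bounded bounded_subset by blast
  from Liouville_theorem[OF hol this] have "h z = h 0"
    by (auto simp: constant_on_def)
  thus ?thesis
    using z lattice1_0 g0[of z] by (simp add: h_def field_simps)
qed

section \<open>Theta products (Jacobi theta functions without the factor
  \<open>qpoch q q\<close>)\<close>

definition theta :: "complex \<Rightarrow> complex \<Rightarrow> complex" where
  "theta q w = qpoch w q * qpoch (q / w) q"

text \<open>Passing from \<open>w\<close> to \<open>q * w\<close> removes the factor
  \<open>1 - w\<close> from one product and adds \<open>1 - 1 / w\<close> to the other; their ratio
  gives \<open>- 1 / w\<close>. The case \<open>w = 1\<close> is separate because
  \<open>1 - w\<close> gets cancelled.\<close>

lemma theta_mult:
  assumes "norm q < 1" "q \<noteq> 0" "w \<noteq> 0"
  shows "theta q (q * w) = - theta q w / w"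
proof (cases "w = 1")
  case True
  have "qpoch 1 q = 0"
    using qpoch_eq_0_iff[OF assms(1), of 1] by (auto intro: exI[of _ 0])
  thus ?thesis using True by (simp add: theta_def assms)
next
  case False
  have "theta q w * (1 - 1 / w) = (1 - w) * (qpoch (w * q) q * ((1 - 1 / w) * qpoch (q / w) q))"
    using qpoch_head[OF assms(1), of w] by (simp add: theta_def)
  also have "(1 - 1 / w) * qpoch (q / w) q = qpoch (1 / w) q"
    using qpoch_head[OF assms(1), of "1 / w"] by simp
  also have "qpoch (w * q) q * qpoch (1 / w) q = theta q (q * w)"
    using assms by (simp add: theta_def mult_ac)
  finally have "(1 - w) * theta q (q * w) = (1 - w) * (- theta q w / w)"
    using assms(3) by (simp add: field_simps)
  moreover have "1 - w \<noteq> 0" using False by simp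
  ultimately show ?thesis using mult_left_cancel by blast
qed

text \<open>Modulo integers, the first product vanishes at the multiples \<open>- n\<close> of
  \<tau> and the second at the multiples \<open>n + 1\<close>, with \<open>n\<close> a natural
  number; together these are all integral multiples.\<close>

lemma theta_eq_0_iff:
  assumes "Im \<tau> > 0"
  shows "theta (qexp \<tau>) (qexp z) = 0 \<longleftrightarrow> z \<in> lattice1 \<tau>"
proof -
  have q: "norm (qexp \<tau>) < 1" using assms by (simp add: norm_qexp_less_1)
  have 1: "qexp z * qexp \<tau> ^ n = 1 \<longleftrightarrow> z - of_int (- int n) * \<tau> \<in> \<int>" for n
    by (simp add: qexp_add qexp_of_nat_mult flip: qexp_eq_1_iff)
  have 2: "qexp \<tau> / qexp z * qexp \<tau> ^ n = 1 \<longleftrightarrow> z - of_int (int (Suc n)) * \<tau> \<in> \<int>" for n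
  proof -
    have "qexp \<tau> / qexp z * qexp \<tau> ^ n = qexp (- (z - of_int (int (Suc n)) * \<tau>))"
      using qexp_of_nat_mult[of "Suc n" \<tau>] by (simp add: qexp_diff)
    thus ?thesis by (simp only: qexp_eq_1_iff minus_in_Ints_iff)
  qed
  have "theta (qexp \<tau>) (qexp z) = 0 \<longleftrightarrow>
          (\<exists>n. z - of_int (- int n) * \<tau> \<in> \<int>) \<or> (\<exists>n. z - of_int (int (Suc n)) * \<tau> \<in> \<int>)"
    unfolding theta_def mult_eq_0_iff qpoch_eq_0_iff[OF q] 1 2 ..
  also have "\<dots> \<longleftrightarrow> (\<exists>n. z - of_int n * \<tau> \<in> \<int>)"
    by (metis int_cases2 not0_implies_Suc of_nat_0 minus_zero)
  finally show ?thesis by (simp only: lattice1_iff)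
qed

lemma holomorphic_on_theta [holomorphic_intros]:
  assumes "norm q < 1" "f holomorphic_on A" "\<And>z. z \<in> A \<Longrightarrow> f z \<noteq> 0"
  shows "(\<lambda>z. theta q (f z)) holomorphic_on A"
  unfolding theta_def using assms by (intro holomorphic_intros) auto

text \<open>For \<open>r = qexp (\<tau> / 2)\<close> the arguments -1, \<open>r\<close>,
  \<open>- r\<close> belong to the three half periods. There the two products in
  \<open>theta\<close> agree, except for an extra factor 1 - (-1) = 2 at -1, so the result is twice
  a square that \<open>qpoch_euler\<close> evaluates.\<close>

lemma theta_half_periods:
  assumes "norm r < 1" "r \<noteq> 0"
  shows "theta (r ^ 2) (-1) * theta (r ^ 2) r * theta (r ^ 2) (- r) = 2"
proof -
  have q: "norm (r ^ 2) < 1"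
    using assms by (simp add: norm_power power_less_one_iff)
  have "theta (r ^ 2) (-1) * theta (r ^ 2) r * theta (r ^ 2) (- r) =
        2 * (qpoch (- (r ^ 2)) (r ^ 2) * qpoch r (r ^ 2) * qpoch (- r) (r ^ 2)) ^ 2"
    using qpoch_head[OF q, of "-1"] assms
    by (simp add: theta_def power2_eq_square mult_ac)
  thus ?thesis using qpoch_euler[OF assms(1)] by simp
qed

text \<open>Both theta products have a simple zero at \<open>z = 0\<close>. Splitting off
  \<open>1 - w\<close> leaves continuous functions, and the vanishing factors contribute the ratio
  \<open>c\<close> of their derivatives.\<close>

lemma theta_quotient_lim:
  assumes "Im \<tau> > 0" "Im \<tau>' > 0" "c \<noteq> 0"
  shows "((\<lambda>z. theta (qexp \<tau>') (qexp (c * z)) / theta (qexp \<tau>) (qexp z)) \<longlongrightarrow>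
           c * qpoch (qexp \<tau>') (qexp \<tau>') ^ 2 / qpoch (qexp \<tau>) (qexp \<tau>) ^ 2) (at 0)"
proof -
  define k where "k = (\<lambda>q w. qpoch (w * q) q * qpoch (q / w) q)"
  have q: "norm (qexp \<tau>) < 1" "norm (qexp \<tau>') < 1"
    using assms by (auto simp: norm_qexp_less_1)
  have lim: "((\<lambda>z. k q (qexp (c * z))) \<longlongrightarrow> qpoch q q ^ 2) (at 0)" if "norm q < 1" for q c
  proof -
    have "(\<lambda>z. k q (qexp (c * z))) holomorphic_on UNIV"
      unfolding k_def using that by (intro holomorphic_intros) auto
    hence "isCont (\<lambda>z. k q (qexp (c * z))) 0"
      by (meson UNIV_I continuous_on_eq_continuous_at holomorphic_on_imp_continuous_on open_UNIV)
    thus ?thesis by (simp add: isCont_def k_def power2_eq_square)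
  qed
  have der: "((\<lambda>z. (1 - qexp (c * z)) / z) \<longlongrightarrow> - (2 * of_real pi * \<i> * c)) (at 0)" for c
  proof -
    have "((\<lambda>z. 1 - qexp (c * z)) has_field_derivative - (2 * of_real pi * \<i> * c)) (at 0)"
      unfolding qexp_def by (auto intro!: derivative_eq_intros)
    thus ?thesis by (simp add: has_field_derivative_iff)
  qed
  have nz: "qpoch (qexp \<tau>) (qexp \<tau>) \<noteq> 0"
    using qpoch_nonzero[OF q(1), of 1] by simp
  have th: "theta q w = (1 - w) * k q w" if "norm q < 1" for q w
    using qpoch_head[OF that, of w] by (simp add: theta_def k_def)
  have "((\<lambda>z. ((1 - qexp (c * z)) / z * k (qexp \<tau>') (qexp (c * z))) /
              ((1 - qexp (1 * z)) / z * k (qexp \<tau>) (qexp (1 * z)))) \<longlongrightarrow>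
          (- (2 * of_real pi * \<i> * c) * qpoch (qexp \<tau>') (qexp \<tau>') ^ 2) /
          (- (2 * of_real pi * \<i> * 1) * qpoch (qexp \<tau>) (qexp \<tau>) ^ 2)) (at 0)"
    by (intro tendsto_divide tendsto_mult der lim q) (use nz in auto)
  hence "((\<lambda>z. ((1 - qexp (c * z)) / z * k (qexp \<tau>') (qexp (c * z))) /
              ((1 - qexp (1 * z)) / z * k (qexp \<tau>) (qexp (1 * z)))) \<longlongrightarrow>
          c * qpoch (qexp \<tau>') (qexp \<tau>') ^ 2 / qpoch (qexp \<tau>) (qexp \<tau>) ^ 2) (at 0)"
    by simp
  thus ?thesis
    by (rule Lim_transform_within_open[of _ _ _ _ UNIV]) (auto simp: th q)
qed

text \<open>The quadratic exponential cancels the multipliers that the theta products acquire under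
  translation by 1 and \<tau>, so the quotient is doubly periodic; \<open>L\<close> is its limit at
  0.\<close>

lemma theta_inversion:
  assumes \<tau>: "Im \<tau> > 0"
  defines "L \<equiv> qpoch (qexp (-1/\<tau>)) (qexp (-1/\<tau>)) ^ 2 / (\<tau> * qpoch (qexp \<tau>) (qexp \<tau>) ^ 2)"
  assumes z: "z \<notin> lattice1 \<tau>"
  shows "qexp (- (z ^ 2) / (2 * \<tau>) + (1 / 2 - 1 / (2 * \<tau>)) * z) * theta (qexp (-1/\<tau>)) (qexp (z / \<tau>)) =
         L * theta (qexp \<tau>) (qexp z)"
proof (rule elliptic_quotient_constant[OF \<tau> _ _ _ _ _ _ z])
  have \<tau>0: "\<tau> \<noteq> 0" using assms by auto
  have \<tau>': "Im (-1/\<tau>) > 0" using \<tau> by (rule Im_minus_inverse_pos)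
  have q: "norm (qexp \<tau>) < 1" "norm (qexp (-1/\<tau>)) < 1"
    using \<tau> \<tau>' by (auto simp only: norm_qexp_less_1)
  define X where "X = (\<lambda>z. qexp (- (z ^ 2) / (2 * \<tau>) + (1 / 2 - 1 / (2 * \<tau>)) * z))"
  show "(\<lambda>z. X z * theta (qexp (-1/\<tau>)) (qexp (z / \<tau>))) holomorphic_on UNIV"
    unfolding X_def using q \<tau>0 by (intro holomorphic_intros) auto
  show "(\<lambda>z. theta (qexp \<tau>) (qexp z)) holomorphic_on UNIV"
    using q by (intro holomorphic_intros) auto
  show "theta (qexp \<tau>) (qexp z) = 0 \<longleftrightarrow> z \<in> lattice1 \<tau>" for z
    by (rule theta_eq_0_iff[OF \<tau>])
  show "X (z + 1) * theta (qexp (-1/\<tau>)) (qexp ((z + 1) / \<tau>)) * theta (qexp \<tau>) (qexp z) =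
        X z * theta (qexp (-1/\<tau>)) (qexp (z / \<tau>)) * theta (qexp \<tau>) (qexp (z + 1))" for z
  proof -
    have "theta (qexp (-1/\<tau>)) (qexp (-1/\<tau>) * qexp ((z + 1) / \<tau>)) =
          - theta (qexp (-1/\<tau>)) (qexp ((z + 1) / \<tau>)) / qexp ((z + 1) / \<tau>)"
      by (rule theta_mult) (use q in auto)
    also have "qexp (-1/\<tau>) * qexp ((z + 1) / \<tau>) = qexp (z / \<tau>)"
      by (simp add: add_divide_distrib flip: qexp_add)
    finally have *: "theta (qexp (-1/\<tau>)) (qexp ((z + 1) / \<tau>)) =
        - qexp ((z + 1) / \<tau>) * theta (qexp (-1/\<tau>)) (qexp (z / \<tau>))"
      by (simp add: field_simps)
    \<comment> \<open>Writing the sign as \<open>qexp (1 / 2)\<close> reduces the claim to comparing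
      exponents modulo integers.\<close>
    have "X (z + 1) * - qexp ((z + 1) / \<tau>) = X (z + 1) * qexp (1 / 2) * qexp ((z + 1) / \<tau>)"
      by simp
    also have "\<dots> = X z"
      unfolding X_def qexp_add[symmetric]
      by (rule qexp_eqI) (use \<tau>0 in \<open>simp add: field_simps power2_eq_square\<close>)
    finally have **: "X (z + 1) * - qexp ((z + 1) / \<tau>) = X z" .
    show ?thesis unfolding * **[symmetric] by (simp add: mult_ac)
  qed
  show "X (z + \<tau>) * theta (qexp (-1/\<tau>)) (qexp ((z + \<tau>) / \<tau>)) * theta (qexp \<tau>) (qexp z) =
        X z * theta (qexp (-1/\<tau>)) (qexp (z / \<tau>)) * theta (qexp \<tau>) (qexp (z + \<tau>))" for z
  proof -
    have *: "theta (qexp \<tau>) (qexp (z + \<tau>)) = - theta (qexp \<tau>) (qexp z) / qexp z"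
      using theta_mult[of "qexp \<tau>" "qexp z"] q by (simp add: qexp_add mult.commute)
    have **: "qexp ((z + \<tau>) / \<tau>) = qexp (z / \<tau>)"
      using \<tau>0 by (simp add: add_divide_distrib)
    have "X (z + \<tau>) * qexp z = X z * qexp (1/2)"
      unfolding X_def qexp_add[symmetric]
      by (rule qexp_eqI) (use \<tau>0 in \<open>simp add: field_simps power2_eq_square\<close>)
    hence "X (z + \<tau>) = - X z / qexp z" by (simp add: field_simps)
    thus ?thesis unfolding * ** by simp
  qed
  have "isCont X 0"
    unfolding X_def qexp_def using \<tau>0 by (intro continuous_intros) auto
  hence "(X \<longlongrightarrow> 1) (at 0)"
    by (simp add: isCont_def X_def)
  from tendsto_mult[OF this theta_quotient_lim[OF \<tau> \<tau>', of "1 / \<tau>"]] \<tau>0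
  show "((\<lambda>z. X z * theta (qexp (-1/\<tau>)) (qexp (z / \<tau>)) / theta (qexp \<tau>) (qexp z)) \<longlongrightarrow> L) (at 0)"
    by (simp add: L_def)
qed

section \<open>From theta products to the eta function\<close>

definition eta :: "complex \<Rightarrow> complex" where
  "eta \<tau> = qexp (\<tau> / 24) * qpoch (qexp \<tau>) (qexp \<tau>)"

lemma eta_nonzero: "Im \<tau> > 0 \<Longrightarrow> eta \<tau> \<noteq> 0"
  using qpoch_nonzero[of "qexp \<tau>" 1] by (simp add: eta_def norm_qexp_less_1)

lemma holomorphic_on_eta:
  assumes "f holomorphic_on A" "\<And>z. z \<in> A \<Longrightarrow> Im (f z) > 0"
  shows "(\<lambda>z. eta (f z)) holomorphic_on A"
proof -
  have "(\<lambda>q. qpoch q q) \<circ> (\<lambda>z. qexp (f z)) holomorphic_on A"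
  proof (rule holomorphic_on_compose_gen)
    show "(\<lambda>q. qpoch q q) holomorphic_on ball 0 1"
      using qpoch_holomorphic[of 1] by simp
  qed (use assms in \<open>auto simp: norm_qexp_less_1 intro!: holomorphic_intros\<close>)
  thus ?thesis
    unfolding eta_def o_def by (intro holomorphic_intros assms) auto
qed

lemma half_period_notin_lattice1:
  assumes "Im \<tau> > 0"
  shows "of_real c + \<tau> / 2 \<notin> lattice1 \<tau>"
proof
  assume "of_real c + \<tau> / 2 \<in> lattice1 \<tau>"
  then obtain m n :: int where "of_real c + \<tau> / 2 = of_int m + of_int n * \<tau>"
    by (auto simp: lattice1_def)
  from arg_cong[OF this, of Im] have "Im \<tau> * 1 = Im \<tau> * of_int (2 * n)" by (auto simp: mult.commute)
  hence "real_of_int 1 = of_int (2 * n)"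
    using assms by (metis less_irrefl mult_left_cancel of_int_1)
  hence "1 = 2 * n" by (simp only: of_int_eq_iff)
  thus False by presburger
qed

text \<open>\<open>theta_inversion\<close> is evaluated at 1/2, \<tau>/2 and (1+\<tau>)/2, and the
  three equations are multiplied. The theta values multiply to 2 on either side, so
  \<open>L ^ 3\<close> is an explicit exponential. As \<open>L\<close> contains squares of Euler
  products, this yields sixth powers of eta.\<close>

lemma eta_inversion_pow6:
  assumes \<tau>: "Im \<tau> > 0"
  shows "eta (-1 / \<tau>) ^ 6 = \<i> * \<tau> ^ 3 * eta \<tau> ^ 6"
proof -
  have \<tau>0: "\<tau> \<noteq> 0" using \<tau> by auto
  have \<tau>': "Im (-1 / \<tau>) > 0" using \<tau> by (rule Im_minus_inverse_pos)
  define q where "q = qexp \<tau>"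
  define q' where "q' = qexp (-1 / \<tau>)"
  define r where "r = qexp (\<tau> / 2)"
  define r' where "r' = qexp (-1 / (2 * \<tau>))"
  define L where "L = qpoch q' q' ^ 2 / (\<tau> * qpoch q q ^ 2)"
  have q: "norm q < 1" "norm q' < 1" "q \<noteq> 0" "q' \<noteq> 0" "r \<noteq> 0" "r' \<noteq> 0"
    using \<tau> \<tau>' by (auto simp only: norm_qexp_less_1 q_def q'_def r_def r'_def qexp_nonzero)
  have q_eq: "q = r ^ 2" "q' = r' ^ 2"
    by (simp_all add: q_def r_def q'_def r'_def power2_eq_square flip: qexp_add)
  have r: "norm r < 1" "norm r' < 1"
    using q q_eq by (auto simp: norm_power power_less_one_iff)
  have E: "qpoch q q \<noteq> 0" using qpoch_nonzero[of q 1] q by simp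
  have inv: "qexp (- (z ^ 2) / (2 * \<tau>) + (1 / 2 - 1 / (2 * \<tau>)) * z) * theta q' (qexp (z / \<tau>)) =
               L * theta q (qexp z)" if "z \<notin> lattice1 \<tau>" for z
    using theta_inversion[OF \<tau> that] by (simp add: q_def q'_def L_def)
  have "qexp (1 / 2 / \<tau>) * r' = 1"
    by (simp add: r'_def flip: qexp_add)
  hence r'': "1 / r' = qexp (1 / 2 / \<tau>)"
    using q by (simp add: divide_eq_eq)
  have A: "L * theta q (-1) = - qexp (1 / 4 + 1 / (8 * \<tau>)) * theta q' r'"
  proof -
    \<comment> \<open>As \<open>q' = r' ^ 2\<close>, quasi-periodicity turns \<open>1 / r'\<close>
      into \<open>r'\<close>.\<close>
    have "theta q' (q' * (1 / r')) = - theta q' (1 / r') / (1 / r')"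
      by (rule theta_mult) (use q in auto)
    hence t: "theta q' (1 / r') = - theta q' r' / r'"
      using q by (simp add: q_eq power2_eq_square field_simps)
    have "L * theta q (-1) = qexp (- ((1/2) ^ 2) / (2 * \<tau>) + (1 / 2 - 1 / (2 * \<tau>)) * (1 / 2)) * theta q' (1 / r')"
      using inv[OF half_notin_lattice1[OF \<tau>]] by (simp add: r'')
    also have "\<dots> = - (qexp (- ((1/2) ^ 2) / (2 * \<tau>) + (1 / 2 - 1 / (2 * \<tau>)) * (1 / 2)) * qexp (1 / 2 / \<tau>)) * theta q' r'"
      unfolding t r''[symmetric] by simp
    also have "qexp (- ((1/2) ^ 2) / (2 * \<tau>) + (1 / 2 - 1 / (2 * \<tau>)) * (1 / 2)) * qexp (1 / 2 / \<tau>) =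
               qexp (1 / 4 + 1 / (8 * \<tau>))"
      unfolding qexp_add[symmetric]
      by (rule arg_cong[of _ _ qexp]) (use \<tau>0 in \<open>simp add: field_simps power2_eq_square\<close>)
    finally show ?thesis .
  qed
  have B: "L * theta q r = qexp (\<tau> / 8 - 1 / 4) * theta q' (-1)"
  proof -
    have "L * theta q r = qexp (- ((\<tau>/2) ^ 2) / (2 * \<tau>) + (1 / 2 - 1 / (2 * \<tau>)) * (\<tau> / 2)) * theta q' (-1)"
      using inv[OF half_period_notin_lattice1[OF \<tau>, of 0, simplified]] \<tau>0 by (simp add: r_def)
    also have "- ((\<tau>/2) ^ 2) / (2 * \<tau>) + (1 / 2 - 1 / (2 * \<tau>)) * (\<tau> / 2) = \<tau> / 8 - 1 / 4"
      using \<tau>0 by (simp add: field_simps power2_eq_square)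
    finally show ?thesis .
  qed
  have C: "L * theta q (- r) = qexp (1 / (8 * \<tau>) - 1 / 4 + \<tau> / 8) * theta q' (- r')"
  proof -
    have "theta q' (q' * (- 1 / r')) = - theta q' (- 1 / r') / (- 1 / r')"
      by (rule theta_mult) (use q in auto)
    hence t: "theta q' (- 1 / r') = theta q' (- r') / r'"
      using q by (simp add: q_eq power2_eq_square field_simps)
    have r3: "qexp ((1 / 2 + \<tau> / 2) / \<tau>) = - 1 / r'"
      using \<tau>0 r'' by (simp add: add_divide_distrib qexp_add)
    have r4: "qexp (1 / 2 + \<tau> / 2) = - r"
      by (simp add: qexp_add r_def)
    have "L * theta q (- r) = qexp (- ((1 / 2 + \<tau> / 2) ^ 2) / (2 * \<tau>) + (1 / 2 - 1 / (2 * \<tau>)) * (1 / 2 + \<tau> / 2)) *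
            theta q' (- 1 / r')"
      using inv[OF half_period_notin_lattice1[OF \<tau>, of "1/2"]]
      unfolding of_real_divide of_real_1 of_real_numeral r3 r4 by simp
    also have "\<dots> = (qexp (- ((1 / 2 + \<tau> / 2) ^ 2) / (2 * \<tau>) + (1 / 2 - 1 / (2 * \<tau>)) * (1 / 2 + \<tau> / 2)) *
                   qexp (1 / 2 / \<tau>)) * theta q' (- r')"
      unfolding t r''[symmetric] by simp
    also have "qexp (- ((1 / 2 + \<tau> / 2) ^ 2) / (2 * \<tau>) + (1 / 2 - 1 / (2 * \<tau>)) * (1 / 2 + \<tau> / 2)) *
                 qexp (1 / 2 / \<tau>) = qexp (1 / (8 * \<tau>) - 1 / 4 + \<tau> / 8)"
      unfolding qexp_add[symmetric]
      by (rule arg_cong[of _ _ qexp]) (use \<tau>0 in \<open>simp add: field_simps power2_eq_square\<close>)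
    finally show ?thesis .
  qed
  have i: "qexp (1 / 4) = \<i>"
  proof -
    have "2 * complex_of_real pi * \<i> * (1 / 4) = \<i> * of_real (pi / 2)" by simp
    thus ?thesis unfolding qexp_def by (simp only: cis_conv_exp[symmetric] cis_pi_half)
  qed
  have "L ^ 3 * 2 = (L * theta q (-1)) * (L * theta q r) * (L * theta q (- r))"
    using theta_half_periods[OF r(1)] q by (simp add: q_eq power3_eq_cube mult_ac)
  also have "\<dots> = - (qexp (1 / 4 + 1 / (8 * \<tau>)) * qexp (\<tau> / 8 - 1 / 4) * qexp (1 / (8 * \<tau>) - 1 / 4 + \<tau> / 8)) * 2"
    unfolding A B C using theta_half_periods[OF r(2)] q by (simp add: q_eq mult_ac)
  also have "qexp (1 / 4 + 1 / (8 * \<tau>)) * qexp (\<tau> / 8 - 1 / 4) * qexp (1 / (8 * \<tau>) - 1 / 4 + \<tau> / 8) =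
             qexp (- (1 / 4)) * qexp ((\<tau> + 1 / \<tau>) / 4)"
    unfolding qexp_add[symmetric]
    by (rule arg_cong[of _ _ qexp]) (use \<tau>0 in \<open>simp add: field_simps\<close>)
  finally have L3: "L ^ 3 = \<i> * qexp ((\<tau> + 1 / \<tau>) / 4)"
    by (simp add: qexp_minus i)
  have p6: "qexp (z / 24) ^ 6 = qexp (z / 4)" for z
    using qexp_numeral_mult[of "num.Bit0 (num.Bit1 num.One)" "z / 24"] by simp
  have "eta (-1 / \<tau>) ^ 6 = qexp (-1 / \<tau> / 4) * (qpoch q' q' ^ 2) ^ 3"
    by (simp only: eta_def power_mult_distrib p6 q'_def) (simp flip: power_mult)
  also have "qpoch q' q' ^ 2 = L * \<tau> * qpoch q q ^ 2"
    using \<tau>0 E by (simp add: L_def)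
  also have "qexp (-1 / \<tau> / 4) * (L * \<tau> * qpoch q q ^ 2) ^ 3 =
             \<i> * (qexp (-1 / \<tau> / 4) * qexp ((\<tau> + 1 / \<tau>) / 4)) * \<tau> ^ 3 * qpoch q q ^ 6"
    by (simp add: power_mult_distrib L3 flip: power_mult)
  also have "qexp (-1 / \<tau> / 4) * qexp ((\<tau> + 1 / \<tau>) / 4) = qexp (\<tau> / 4)"
    unfolding qexp_add[symmetric]
    by (rule arg_cong[of _ _ qexp]) (use \<tau>0 in \<open>simp add: field_simps\<close>)
  also have "\<i> * qexp (\<tau> / 4) * \<tau> ^ 3 * qpoch q q ^ 6 = \<i> * \<tau> ^ 3 * eta \<tau> ^ 6"
    by (simp only: eta_def power_mult_distrib p6 q_def) simp
  finally show ?thesis .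
qed

text \<open>The ratio of the two sides is continuous on the connected half-plane with values among
  the sixth roots of unity, so it is constant; the fixed point \<i> of the inversion gives the value
  1.\<close>

theorem eta_inversion:
  assumes "Im \<tau> > 0"
  shows "eta (-1 / \<tau>) = csqrt (- \<i> * \<tau>) * eta \<tau>"
proof -
  define H where "H = {\<tau>. Im \<tau> > 0}"
  define \<rho> where "\<rho> = (\<lambda>\<tau>. eta (-1 / \<tau>) / (csqrt (- \<i> * \<tau>) * eta \<tau>))"
  have 6: "\<rho> \<tau> ^ 6 = 1" if "Im \<tau> > 0" for \<tau>
  proof -
    have "csqrt (- \<i> * \<tau>) ^ 6 = (csqrt (- \<i> * \<tau>) ^ 2) ^ 3"
      by (simp only: flip: power_mult) simp
    also have "\<dots> = \<i> * \<tau> ^ 3"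
      unfolding power2_csqrt by (simp add: power_mult_distrib) (simp add: power3_eq_cube)
    finally have "csqrt (- \<i> * \<tau>) ^ 6 = \<i> * \<tau> ^ 3" .
    moreover have "\<tau> \<noteq> 0" using that by auto
    ultimately show ?thesis
      using eta_nonzero[OF that]
      by (simp only: \<rho>_def power_divide power_mult_distrib eta_inversion_pow6[OF that]) simp
  qed
  have "\<rho> constant_on H"
  proof (rule continuous_finite_range_constant)
    show "connected H"
      by (simp add: H_def convex_connected convex_halfspace_Im_gt)
    have "\<rho> holomorphic_on H"
      unfolding \<rho>_def H_def
      by (intro holomorphic_intros holomorphic_on_eta)
         (use eta_nonzero Im_minus_inverse_pos in \<open>auto simp: complex_nonpos_Reals_iff\<close>)
    thus "continuous_on H \<rho>" by (rule holomorphic_on_imp_continuous_on)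
    have "\<rho> ` H \<subseteq> {w. w ^ 6 = 1}" using 6 by (auto simp: H_def)
    thus "finite (\<rho> ` H)" by (rule finite_subset) (rule finite_roots_unity, simp)
  qed
  hence "\<rho> \<tau> = \<rho> \<i>" using assms by (auto simp: constant_on_def H_def)
  also have "-1 / \<i> = \<i>" by (simp add: divide_i)
  hence "\<rho> \<i> = 1" using eta_nonzero[of \<i>] by (simp add: \<rho>_def)
  finally show ?thesis
    using eta_nonzero[OF assms] by (auto simp: \<rho>_def divide_simps split: if_splits)
qed

section \<open>Modular forms on the Fricke group of level two\<close>

text \<open>Every nonzero \<open>q\<close> in the disc is some \<open>qexp z\<close>, so
  \<open>h'\<close> takes a value of \<open>h\<close> there; the origin, which corresponds to the
  cusp, is filled by continuity.\<close>

lemma fricke_pair_constant_aux: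
  assumes h: "h holomorphic_on ball 0 1" and h': "h' holomorphic_on ball 0 1"
  assumes inv: "\<And>\<tau>. Im \<tau> > 0 \<Longrightarrow> h (qexp (-1 / (2 * \<tau>))) = h' (qexp \<tau>)"
  assumes const: "\<And>q. q \<in> ball 0 1 \<Longrightarrow> h q = c"
  assumes q: "q \<in> ball 0 1"
  shows "h' q = c"
proof -
  have *: "h' q = c" if "q \<in> ball 0 1" "q \<noteq> 0" for q
  proof -
    obtain z where z: "q = qexp z" using qexp_surj[OF \<open>q \<noteq> 0\<close>] by metis
    hence "Im z > 0" using that by (simp add: norm_qexp_less_1)
    moreover from this have "qexp (-1 / (2 * z)) \<in> ball 0 1"
      using Im_minus_inverse_pos[of "2 * z"] norm_qexp_less_1[of "-1 / (2 * z)"] by simp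
    ultimately show ?thesis using inv[of z] const z by metis
  qed
  have "(h' \<longlongrightarrow> h' 0) (at 0)"
    using h' by (metis centre_in_ball continuous_on_eq_continuous_at holomorphic_on_imp_continuous_on
        isCont_def open_ball zero_less_one)
  moreover have "(h' \<longlongrightarrow> c) (at 0)"
    by (rule Lim_transform_within_open[OF tendsto_const, of "ball 0 1"]) (use * in auto)
  ultimately have "h' 0 = c" by (rule tendsto_unique[rotated]) auto
  thus ?thesis using * q by metis
qed

text \<open>
  The segment \<open>Im \<tau> = 2/5\<close>, \<open>|Re \<tau>| \<le> 1/2\<close> covers a circle in the \<open>q\<close>-disc, and \<open>\<tau> \<mapsto> -1/(2\<tau>)\<close>
  maps it into the region \<open>Im \<tau> > 2/5\<close>, that is, inside this circle; so one of the two functions attains its maximum modulus in an interior point.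
\<close>

lemma fricke_pair_constant:
  assumes h: "h holomorphic_on ball 0 1" and h': "h' holomorphic_on ball 0 1"
  assumes inv: "\<And>\<tau>. Im \<tau> > 0 \<Longrightarrow> h (qexp (-1 / (2 * \<tau>))) = h' (qexp \<tau>)"
  assumes q: "q \<in> ball 0 1"
  shows "h q = h 0" "h' q = h 0"
proof -
  \<comment> \<open>This is the modulus of \<open>qexp \<tau>\<close> for
    \<open>Im \<tau> = 2/5\<close>.\<close>
  define r where "r = exp (- (4 / 5 * pi))"
  have r: "0 < r" "r < 1" by (auto simp: r_def)
  have inv': "h' (qexp (-1 / (2 * \<tau>))) = h (qexp \<tau>)" if "Im \<tau> > 0" for \<tau>
    using inv[of "-1 / (2 * \<tau>)"] Im_minus_inverse_pos[of "2 * \<tau>"] that by simp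
  have bdry: "\<exists>q'. norm q' < r \<and> f q = g q'"
    if inv: "\<And>\<tau>. Im \<tau> > 0 \<Longrightarrow> g (qexp (-1 / (2 * \<tau>))) = f (qexp \<tau>)" and q: "norm q = r"
    for f g :: "complex \<Rightarrow> complex" and q
  proof -
    have "q \<noteq> 0" using q r by auto
    then obtain z where z: "q = qexp z" "\<bar>Re z\<bar> \<le> 1 / 2" using qexp_surj by metis
    have "exp (- 2 * pi * Im z) = exp (- (4 / 5 * pi))"
      using q by (simp add: z norm_qexp r_def)
    hence Im: "Im z = 2 / 5" by simp
    \<comment> \<open>The square of |z| is at most 1/4 + 4/25 < 1/2, and
      \<open>Im (-1 / (2 * z))\<close> is \<open>Im z\<close> divided by twice that square.\<close>
    have "(Re z) ^ 2 \<le> (1 / 2) ^ 2"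
      using z(2) by (metis abs_le_square_iff abs_of_nonneg divide_nonneg_nonneg zero_le_numeral zero_le_one)
    hence "(Re z)\<^sup>2 + (Im z)\<^sup>2 < 1 / 2" by (simp add: Im power2_eq_square)
    moreover have "(Re z)\<^sup>2 + (Im z)\<^sup>2 > 0" using Im by (simp add: add_nonneg_pos)
    moreover have "Im (-1 / (2 * z)) = 2 * Im z / (4 * ((Re z)\<^sup>2 + (Im z)\<^sup>2))"
      by (simp add: Im_divide power2_eq_square algebra_simps)
    moreover have "2 / 5 < 2 * (2 / 5) / (4 * D)" if "D < 1 / 2" "D > 0" for D :: real
      using that by (simp add: field_simps)
    ultimately have "Im (-1 / (2 * z)) > 2 / 5"
      by (simp only: Im)
    hence "pi * (2 / 5) < pi * Im (-1 / (2 * z))"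
      by (intro mult_strict_left_mono) auto
    hence "norm (qexp (-1 / (2 * z))) < r"
      unfolding norm_qexp r_def exp_less_cancel_iff by linarith
    moreover have "f q = g (qexp (-1 / (2 * z)))"
      using inv[of z] Im by (simp add: z)
    ultimately show ?thesis by blast
  qed
  have max_const: "\<And>q. q \<in> ball 0 1 \<Longrightarrow> f q = f 0"
    if f: "f holomorphic_on ball 0 1" and q0: "norm q0 < r"
      and max: "\<And>q. norm q \<le> r \<Longrightarrow> norm (f q) \<le> norm (f q0)" for f :: "complex \<Rightarrow> complex" and q0
  proof -
    have "f constant_on ball 0 1"
      by (rule maximum_modulus_principle[OF f open_ball connected_ball, of "ball 0 r" q0])
         (use q0 max r in auto)
    thus "f q = f 0" if "q \<in> ball 0 1" for q
      using that by (metis centre_in_ball constant_on_def zero_less_one)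
  qed
  \<comment> \<open>Here \<open>f\<close> is the function with the larger maximum on the closed
    disc. If that maximum sits on the circle, \<open>g\<close> takes the same value inside, and this
    is then the maximum of |g|.\<close>
  have main: "\<exists>f\<in>{f, g}. \<forall>q\<in>ball 0 1. f q = f 0"
    if f: "f holomorphic_on ball 0 1" and g: "g holomorphic_on ball 0 1"
      and inv: "\<And>\<tau>. Im \<tau> > 0 \<Longrightarrow> g (qexp (-1 / (2 * \<tau>))) = f (qexp \<tau>)"
      and q0: "norm q0 \<le> r" "\<And>q. norm q \<le> r \<Longrightarrow> norm (f q) \<le> norm (f q0)"
      and le: "\<And>q. norm q \<le> r \<Longrightarrow> norm (g q) \<le> norm (f q0)"
    for f g :: "complex \<Rightarrow> complex" and q0
  proof (cases "norm q0 < r")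
    case True
    thus ?thesis using max_const[OF f True q0(2)] by blast
  next
    case False
    hence "norm q0 = r" using q0 by simp
    from bdry[where f = f and g = g, OF inv this] obtain q1
      where q1: "norm q1 < r" "f q0 = g q1" by blast
    have "norm (g q) \<le> norm (g q1)" if "norm q \<le> r" for q
      using le[OF that] q1 by simp
    thus ?thesis using max_const[OF g q1(1)] by blast
  qed
  have sup: "\<exists>q0. norm q0 \<le> r \<and> (\<forall>q. norm q \<le> r \<longrightarrow> norm (f q) \<le> norm (f q0))"
    if "f holomorphic_on ball 0 1" for f :: "complex \<Rightarrow> complex"
  proof -
    have "continuous_on (cball 0 r) (\<lambda>q. norm (f q))"
      using r by (intro continuous_intros holomorphic_on_imp_continuous_on holomorphic_on_subset[OF that]) auto
    from continuous_attains_sup[OF compact_cball _ this] r show ?thesis by (force simp: dist_norm)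
  qed
  obtain q0 where q0: "norm q0 \<le> r" "\<And>q. norm q \<le> r \<Longrightarrow> norm (h q) \<le> norm (h q0)"
    using sup[OF h] by blast
  obtain q1 where q1: "norm q1 \<le> r" "\<And>q. norm q \<le> r \<Longrightarrow> norm (h' q) \<le> norm (h' q1)"
    using sup[OF h'] by blast
  have "\<exists>f\<in>{h, h'}. \<forall>q\<in>ball 0 1. f q = f 0"
  proof (cases "norm (h' q1) \<le> norm (h q0)")
    case True
    thus ?thesis using main[OF h h' inv' q0] q1 by (meson order_trans)
  next
    case False
    hence "norm (h q) \<le> norm (h' q1)" if "norm q \<le> r" for q
      using q0(2)[OF that] by linarith
    thus ?thesis using main[OF h' h inv q1] by blast
  qed
  then consider "\<forall>q\<in>ball 0 1. h q = h 0" | "\<forall>q\<in>ball 0 1. h' q = h' 0"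
    by blast
  hence "h q = h 0 \<and> h' q = h 0" 
  proof cases
    case 1
    from fricke_pair_constant_aux[OF h h' inv bspec[OF 1] q] show ?thesis using 1 q by blast
  next
    case 2
    have "h q = h' 0" if "q \<in> ball 0 1" for q
      by (rule fricke_pair_constant_aux[OF h' h inv' bspec[OF 2] that])
    from this[OF q] this[of 0] bspec[OF 2 q] show ?thesis by simp
  qed
  thus "h q = h 0" "h' q = h 0" by simp_all
qed

section \<open>Eta quotients and their orders at the two cusps\<close>

lemma qexp_of_int_mult: "qexp (of_int n * z) = qexp z powi n"
  by (simp add: qexp_def exp_power_int mult_ac)

definition etaq :: "int \<Rightarrow> int \<Rightarrow> complex \<Rightarrow> complex" where
  "etaq x y q = qpoch q q powi x * qpoch (q ^ 2) (q ^ 2) powi y"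

lemma etaq_nonzero: "norm q < 1 \<Longrightarrow> etaq x y q \<noteq> 0"
  using qpoch_nonzero[of q 1] qpoch_nonzero[of q 2] by (simp add: etaq_def power_int_eq_0_iff)

lemma etaq_add: "norm q < 1 \<Longrightarrow> etaq (x + x') (y + y') q = etaq x y q * etaq x' y' q"
  using qpoch_nonzero[of q 1] qpoch_nonzero[of q 2] by (simp add: etaq_def power_int_add)

lemma etaq_at_0 [simp]: "etaq x y 0 = 1"
  by (simp add: etaq_def qpoch_def)

lemma holomorphic_on_etaq:
  assumes "f holomorphic_on A" "\<And>z. z \<in> A \<Longrightarrow> norm (f z) < 1"
  shows "(\<lambda>z. etaq x y (f z)) holomorphic_on A"
proof -
  have "etaq x y holomorphic_on ball 0 1"
    unfolding etaq_def using qpoch_holomorphic[of 1] qpoch_holomorphic[of 2] qpoch_nonzero[of _ 1] qpoch_nonzero[of _ 2]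
    by (intro holomorphic_intros) auto
  hence "etaq x y \<circ> f holomorphic_on A"
    by (rule holomorphic_on_compose_gen[OF assms(1)]) (use assms(2) in auto)
  thus ?thesis by (simp add: o_def)
qed

lemma eta_powi:
  assumes "Im \<tau> > 0"
  shows "eta \<tau> powi x * eta (2 * \<tau>) powi y = qexp (of_int (x + 2 * y) * \<tau> / 24) * etaq x y (qexp \<tau>)"
proof -
  have "qexp (2 * \<tau>) = qexp \<tau> ^ 2"
    by (rule qexp_numeral_mult)
  moreover have "qexp (\<tau> / 24) powi x * qexp (2 * \<tau> / 24) powi y = qexp (of_int (x + 2 * y) * \<tau> / 24)"
    by (simp add: add_divide_distrib ring_distribs mult_ac add_ac flip: qexp_of_int_mult qexp_add)
  ultimately show ?thesis
    by (simp add: eta_def etaq_def power_int_mult_distrib mult_ac)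
qed

text \<open>The map \<tau> to -1/(2\<tau>) interchanges \<open>eta \<tau>\<close> and
  \<open>eta (2 * \<tau>)\<close> up to square roots, so the exponents swap. The even total exponent
  turns the square roots into \<open>\<tau> ^ k\<close>.\<close>

lemma eta_powi_inversion:
  assumes "x + y = 2 * int k"
  obtains C where "C \<noteq> 0"
    "\<And>\<tau>. Im \<tau> > 0 \<Longrightarrow> eta (-1 / (2 * \<tau>)) powi x * eta (2 * (-1 / (2 * \<tau>))) powi y =
              C * \<tau> ^ k * (eta \<tau> powi y * eta (2 * \<tau>) powi x)"
proof -
  define s where "s = complex_of_real (sqrt 2)"
  have s: "s \<noteq> 0" "s ^ 2 = 2" by (auto simp: s_def simp flip: of_real_power)
  show ?thesis
  proof (rule that[of "s powi x * (- \<i>) ^ k"])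
    show "s powi x * (- \<i>) ^ k \<noteq> 0" using s by simp
    fix \<tau> :: complex assume \<tau>: "Im \<tau> > 0"
    define w where "w = csqrt (- \<i> * \<tau>)"
    have w0: "w \<noteq> 0" using \<tau> by (auto simp: w_def)
    \<comment> \<open>The resulting positivity of \<open>Re w\<close> makes \<open>s * w\<close> the
      principal root rather than its negative.\<close>
    have "cmod (\<i> * \<tau>) + Im \<tau> > 0"
      using \<tau> by (intro add_nonneg_pos) auto
    hence Rew: "Re w > 0"
      by (simp add: w_def)
    have "csqrt (- \<i> * (2 * \<tau>)) = s * w"
    proof (rule csqrt_unique)
      show "(s * w) ^ 2 = - \<i> * (2 * \<tau>)"
        by (simp add: power_mult_distrib s w_def)
      show "0 < Re (s * w) \<or> Re (s * w) = 0 \<and> 0 \<le> Im (s * w)"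
        using Rew by (simp add: s_def)
    qed
    hence "eta (-1 / (2 * \<tau>)) powi x * eta (2 * (-1 / (2 * \<tau>))) powi y =
           (s * w * eta (2 * \<tau>)) powi x * (w * eta \<tau>) powi y"
      using eta_inversion[of "2 * \<tau>"] eta_inversion[OF \<tau>] \<tau> by (simp add: w_def)
    also have "\<dots> = s powi x * (w powi (x + y)) * (eta \<tau> powi y * eta (2 * \<tau>) powi x)"
      using w0 by (simp add: power_int_mult_distrib power_int_add mult_ac)
    also have "w powi (x + y) = (w ^ 2) ^ k"
      unfolding assms by (simp add: power_int_mult flip: power_mult)
    also have "\<dots> = (- \<i>) ^ k * \<tau> ^ k"
      unfolding w_def power2_csqrt power_mult_distrib ..
    finally show "eta (-1 / (2 * \<tau>)) powi x * eta (2 * (-1 / (2 * \<tau>))) powi y =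
              s powi x * (- \<i>) ^ k * \<tau> ^ k * (eta \<tau> powi y * eta (2 * \<tau>) powi x)"
      by (simp add: mult_ac)
  qed
qed

text \<open>
  With \<open>F \<tau> = q\<^bsup>M/24\<^esup> p(q)\<close> and \<open>G \<tau> = q\<^bsup>N/24\<^esup> p'(q)\<close>, where \<open>q = exp(2\<pi>i\<tau>)\<close>, the last conjunct says
  \<open>F(-1/(2\<tau>)) = \<tau>\<^sup>k G(\<tau>)\<close>: \<open>p\<close> and \<open>p'\<close> are the expansions of one form of weight \<open>k\<close> at the two
  cusps of \<open>\<Gamma>\<^sub>0(2)\<close>.
\<close>

definition cusp_pair :: "nat \<Rightarrow> int \<Rightarrow> int \<Rightarrow> (complex \<Rightarrow> complex) \<Rightarrow> (complex \<Rightarrow> complex) \<Rightarrow> bool" where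
  "cusp_pair k M N p p' \<longleftrightarrow> p holomorphic_on ball 0 1 \<and> p' holomorphic_on ball 0 1 \<and>
     (\<forall>\<tau>. Im \<tau> > 0 \<longrightarrow> qexp (of_int M * (-1 / (2 * \<tau>)) / 24) * p (qexp (-1 / (2 * \<tau>))) =
                       \<tau> ^ k * (qexp (of_int N * \<tau> / 24) * p' (qexp \<tau>)))"

text \<open>Both expansions have nonzero constant term, so \<open>x + 2 * y\<close> and
  \<open>y + 2 * x\<close> are the exact orders at the cusps in units of 1/24. They add up to 6k,
  the total fixed by weight \<open>k\<close>.\<close>

lemma cusp_pair_etaq:
  assumes "x + y = 2 * int k"
  obtains C where "C \<noteq> 0" "cusp_pair k (x + 2 * y) (y + 2 * x) (etaq x y) (\<lambda>q. C * etaq y x q)"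
proof -
  obtain C where C: "C \<noteq> 0"
    "\<And>\<tau>. Im \<tau> > 0 \<Longrightarrow> eta (-1 / (2 * \<tau>)) powi x * eta (2 * (-1 / (2 * \<tau>))) powi y =
              C * \<tau> ^ k * (eta \<tau> powi y * eta (2 * \<tau>) powi x)"
    using eta_powi_inversion[OF assms] by metis
  have "cusp_pair k (x + 2 * y) (y + 2 * x) (etaq x y) (\<lambda>q. C * etaq y x q)"
    unfolding cusp_pair_def
  proof (intro conjI allI impI)
    fix \<tau> :: complex assume \<tau>: "Im \<tau> > 0"
    have \<tau>': "Im (-1 / (2 * \<tau>)) > 0"
      by (rule Im_minus_inverse_pos) (use \<tau> in simp)
    show "qexp (of_int (x + 2 * y) * (-1 / (2 * \<tau>)) / 24) * etaq x y (qexp (-1 / (2 * \<tau>))) =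
          \<tau> ^ k * (qexp (of_int (y + 2 * x) * \<tau> / 24) * (C * etaq y x (qexp \<tau>)))"
      using C(2)[OF \<tau>] unfolding eta_powi[OF \<tau>] eta_powi[OF \<tau>'] by (simp add: mult_ac)
  qed (intro holomorphic_intros holomorphic_on_etaq; auto)+
  with C(1) show ?thesis using that by blast
qed

text \<open>Dividing by the eta quotient with the same orders, which has no zeros in the half-plane,
  gives a pole-free pair of weight zero; \<open>fricke_pair_constant\<close> makes it
  constant.\<close>

lemma cusp_pair_unique:
  assumes p: "cusp_pair k M N p p'" and xy: "x + y = 2 * int k" "M = x + 2 * y" "N = y + 2 * x"
  obtains c d where "\<And>q. norm q < 1 \<Longrightarrow> p q = c * etaq x y q" "\<And>q. norm q < 1 \<Longrightarrow> p' q = d * etaq y x q"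
    "d = 0 \<longleftrightarrow> c = 0"
proof -
  obtain C where C: "C \<noteq> 0" "cusp_pair k M N (etaq x y) (\<lambda>q. C * etaq y x q)"
    using cusp_pair_etaq[OF xy(1)] unfolding xy(2,3) by metis
  define h where "h = (\<lambda>q. p q / etaq x y q)"
  define h' where "h' = (\<lambda>q. p' q / (C * etaq y x q))"
  have hol: "h holomorphic_on ball 0 1" "h' holomorphic_on ball 0 1"
    using p C(1) etaq_nonzero unfolding h_def h'_def cusp_pair_def
    by (auto intro!: holomorphic_intros holomorphic_on_etaq)
  have inv: "h (qexp (-1 / (2 * \<tau>))) = h' (qexp \<tau>)" if \<tau>: "Im \<tau> > 0" for \<tau>
  proof -
    have \<tau>': "Im (-1 / (2 * \<tau>)) > 0"
      by (rule Im_minus_inverse_pos) (use \<tau> in simp)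
    have nz: "etaq x y (qexp (-1 / (2 * \<tau>))) \<noteq> 0" "etaq y x (qexp \<tau>) \<noteq> 0"
      using \<tau> \<tau>' by (auto simp only: etaq_nonzero norm_qexp_less_1)
    have "h (qexp (-1 / (2 * \<tau>))) =
          (qexp (of_int M * (-1 / (2 * \<tau>)) / 24) * p (qexp (-1 / (2 * \<tau>)))) /
          (qexp (of_int M * (-1 / (2 * \<tau>)) / 24) * etaq x y (qexp (-1 / (2 * \<tau>))))"
      by (simp add: h_def)
    also have "\<dots> = (\<tau> ^ k * (qexp (of_int N * \<tau> / 24) * p' (qexp \<tau>))) /
                    (\<tau> ^ k * (qexp (of_int N * \<tau> / 24) * (C * etaq y x (qexp \<tau>))))"
      using p C(2) \<tau> by (simp only: cusp_pair_def)
    also have "\<dots> = h' (qexp \<tau>)"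
      using \<tau> by (auto simp: h'_def)
    finally show ?thesis .
  qed
  have hc: "h q = h 0" "h' q = h 0" if "norm q < 1" for q
    using fricke_pair_constant[OF hol inv, of q] that by auto
  show ?thesis
  proof (rule that[of "h 0" "h 0 * C"])
    show "p q = h 0 * etaq x y q" if "norm q < 1" for q
      using hc(1)[OF that] etaq_nonzero[OF that] unfolding h_def by (simp add: divide_eq_eq)
    show "p' q = h 0 * C * etaq y x q" if "norm q < 1" for q
      using hc(2)[OF that] etaq_nonzero[OF that] C(1) unfolding h'_def by (simp add: divide_eq_eq mult_ac)
    show "h 0 * C = 0 \<longleftrightarrow> h 0 = 0" using C(1) by simp
  qed
qed

text \<open>The orders demand one zero more than the weight permits. Moving a factor
  \<open>q\<close> into the partner balances the orders; the partner is then a multiple of an eta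
  quotient but vanishes at 0, so the multiple is zero.\<close>

lemma cusp_pair_zero:
  assumes p: "cusp_pair k M N p p'" and MN: "M + N = 6 * int k + 24" and q: "norm q < 1"
  shows "p q = 0"
proof -
  \<comment> \<open>These exponents solve x + y = 2k and x + 2y = M.\<close>
  define x where "x = 4 * int k - M"
  define y where "y = M - 2 * int k"
  have xy: "x + y = 2 * int k" "M = x + 2 * y" "N - 24 = y + 2 * x"
    using MN by (auto simp: x_def y_def)
  have N: "qexp (of_int N * \<tau> / 24) = qexp (of_int (N - 24) * \<tau> / 24) * qexp \<tau>" for \<tau>
    unfolding qexp_add[symmetric] by (rule arg_cong[of _ _ qexp]) (simp add: field_simps)
  have "cusp_pair k M (N - 24) p (\<lambda>q. q * p' q)"
    unfolding cusp_pair_def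
  proof (intro conjI allI impI)
    fix \<tau> :: complex assume "Im \<tau> > 0"
    thus "qexp (of_int M * (-1 / (2 * \<tau>)) / 24) * p (qexp (-1 / (2 * \<tau>))) =
          \<tau> ^ k * (qexp (of_int (N - 24) * \<tau> / 24) * (qexp \<tau> * p' (qexp \<tau>)))"
      using p N[of \<tau>] unfolding cusp_pair_def by (simp only: mult_ac)
  qed (use p in \<open>auto simp: cusp_pair_def intro!: holomorphic_intros\<close>)
  then obtain c d where cd: "\<And>q. norm q < 1 \<Longrightarrow> p q = c * etaq x y q"
    "\<And>q. norm q < 1 \<Longrightarrow> q * p' q = d * etaq y x q" "d = 0 \<longleftrightarrow> c = 0"
    by (rule cusp_pair_unique[OF _ xy]) blast
  from cd(2)[of 0] cd(3) have "c = 0" by simp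
  thus ?thesis using cd(1)[OF q] by simp
qed

text \<open>One zero is left free. Subtracting the multiple of \<open>etaq x y\<close> with the same
  constant term and dividing by \<open>q\<close> uses it up, and \<open>cusp_pair_unique\<close>
  applies to the quotient.\<close>

lemma cusp_pair_dim2:
  assumes p: "cusp_pair k M N p p'" and xy: "x + y = 2 * int k" "M = x + 2 * y" "N + 24 = y + 2 * x"
  obtains a b where "\<And>q. norm q < 1 \<Longrightarrow> p q = a * etaq x y q + b * q * etaq (x - 24) (y + 24) q"
proof -
  obtain C where C: "cusp_pair k M (N + 24) (etaq x y) (\<lambda>q. C * etaq y x q)"
    using cusp_pair_etaq[OF xy(1)] unfolding xy(2,3) by metis
  define a where "a = p 0"
  define r where "r = (\<lambda>q. p q - a * etaq x y q)"
  have hol: "r holomorphic_on ball 0 1"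
    using p unfolding cusp_pair_def r_def by (auto intro!: holomorphic_intros holomorphic_on_etaq)
  have "r 0 = 0" by (simp add: r_def a_def)
  define g where "g = (\<lambda>q. if q = 0 then deriv r 0 else (r q - r 0) / (q - 0))"
  have g: "g holomorphic_on ball 0 1"
    unfolding g_def by (rule pole_lemma_open[OF hol open_ball])
  have rg: "r q = q * g q" for q
    by (simp add: g_def \<open>r 0 = 0\<close>)
  have 1: "qexp (of_int (N + 24) * \<tau> / 24) = qexp (of_int N * \<tau> / 24) * qexp \<tau>" for \<tau>
    unfolding qexp_add[symmetric] by (rule arg_cong[of _ _ qexp]) (simp add: field_simps)
  have 2: "qexp (of_int (M + 24) * \<tau> / 24) = qexp (of_int M * \<tau> / 24) * qexp \<tau>" for \<tau>
    unfolding qexp_add[symmetric] by (rule arg_cong[of _ _ qexp]) (simp add: field_simps)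
  have "cusp_pair k (M + 24) N g (\<lambda>q. p' q - a * C * q * etaq y x q)"
    unfolding cusp_pair_def
  proof (intro conjI allI impI)
    show "(\<lambda>q. p' q - a * C * q * etaq y x q) holomorphic_on ball 0 1"
      using p unfolding cusp_pair_def by (auto intro!: holomorphic_intros holomorphic_on_etaq)
    fix \<tau> :: complex assume \<tau>: "Im \<tau> > 0"
    define \<tau>' where "\<tau>' = -1 / (2 * \<tau>)"
    have "r (qexp \<tau>') = qexp \<tau>' * g (qexp \<tau>')"
      by (intro rg)
    hence "qexp (of_int (M + 24) * \<tau>' / 24) * g (qexp \<tau>') = qexp (of_int M * \<tau>' / 24) * r (qexp \<tau>')"
      unfolding 2 by simp
    also have "\<dots> = qexp (of_int M * \<tau>' / 24) * p (qexp \<tau>') - a * (qexp (of_int M * \<tau>' / 24) * etaq x y (qexp \<tau>'))"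
      by (simp add: r_def algebra_simps)
    also have "\<dots> = \<tau> ^ k * (qexp (of_int N * \<tau> / 24) * p' (qexp \<tau>)) -
                    a * (\<tau> ^ k * (qexp (of_int (N + 24) * \<tau> / 24) * (C * etaq y x (qexp \<tau>))))"
      using p C \<tau> unfolding cusp_pair_def \<tau>'_def by simp
    also have "\<dots> = \<tau> ^ k * (qexp (of_int N * \<tau> / 24) * (p' (qexp \<tau>) - a * C * qexp \<tau> * etaq y x (qexp \<tau>)))"
      unfolding 1 by (simp add: algebra_simps)
    finally show "qexp (of_int (M + 24) * (-1 / (2 * \<tau>)) / 24) * g (qexp (-1 / (2 * \<tau>))) =
        \<tau> ^ k * (qexp (of_int N * \<tau> / 24) * (p' (qexp \<tau>) - a * C * qexp \<tau> * etaq y x (qexp \<tau>)))"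
      by (simp only: \<tau>'_def)
  qed (fact g)
  moreover have "(x - 24) + (y + 24) = 2 * int k" "M + 24 = (x - 24) + 2 * (y + 24)" "N = (y + 24) + 2 * (x - 24)"
    using xy by auto
  ultimately obtain b where b: "\<And>q. norm q < 1 \<Longrightarrow> g q = b * etaq (x - 24) (y + 24) q"
    by (rule cusp_pair_unique) blast
  show ?thesis
  proof (rule that[of a b])
    fix q :: complex assume q: "norm q < 1"
    show "p q = a * etaq x y q + b * q * etaq (x - 24) (y + 24) q"
      using rg[of q] b[OF q] by (simp add: r_def algebra_simps)
  qed
qed

section \<open>Hecke sums at the prime five\<close>

text \<open>Inversion carries the Hecke term of a nonzero \<open>b\<close> to that of
  \<open>b'\<close>. The laws for inversion and translation are applied along the chain
  \<open>z\<close>, \<open>\<rho>\<close>, \<open>\<sigma>\<close>, \<open>\<sigma>'\<close>, which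
  closes up because \<open>b * b' = 2\<close> makes the inverses of \<open>\<sigma>\<close> and
  \<open>\<sigma>'\<close> differ by the integer \<open>b\<close>.\<close>

lemma eta_powi_hecke_term:
  fixes F G :: "complex \<Rightarrow> complex" and b b' N N' :: int
  assumes inv: "\<And>\<tau>. Im \<tau> > 0 \<Longrightarrow> F (-1 / (2 * \<tau>)) = C * \<tau> ^ k * G \<tau>" and C: "C \<noteq> 0"
  assumes F: "\<And>\<tau> n. Im \<tau> > 0 \<Longrightarrow> F (\<tau> + of_int n) = qexp (of_int (n * N) / 24) * F \<tau>"
  assumes G: "\<And>\<tau> n. Im \<tau> > 0 \<Longrightarrow> G (\<tau> + of_int n) = qexp (of_int (n * N') / 24) * G \<tau>"
  assumes b: "b * b' = 2" and \<tau>: "Im \<tau> > 0"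
  shows "F ((-1 / (2 * \<tau>) + of_int b) / 5) =
         C * \<tau> ^ k * (qexp (of_int (b * N - b' * N') / 24) * G ((\<tau> + of_int b') / 5))"
proof -
  define z where "z = (-1 / (2 * \<tau>) + of_int b) / 5"
  define \<rho> where "\<rho> = -1 / (2 * z)"
  define \<sigma> where "\<sigma> = \<rho> + of_int b'"
  define \<sigma>' where "\<sigma>' = (\<tau> + of_int b') / 5"
  have "Im (-1 / (2 * \<tau>)) > 0"
    by (rule Im_minus_inverse_pos) (use \<tau> in simp)
  hence z: "Im z > 0" by (simp add: z_def)
  have \<rho>: "Im \<rho> > 0"
    unfolding \<rho>_def by (rule Im_minus_inverse_pos) (use z in simp)
  have \<sigma>: "Im \<sigma> > 0" "Im \<sigma>' > 0"
    using \<rho> \<tau> by (simp_all add: \<sigma>_def \<sigma>'_def)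
  have \<sigma>'': "Im (-1 / (2 * \<sigma>')) > 0"
    by (rule Im_minus_inverse_pos) (use \<sigma> in simp)
  have bb: "of_int b * of_int b' = (2 :: complex)"
    using b by (metis of_int_mult of_int_numeral)
  have "b \<noteq> 0" using b by auto
  hence nz: "\<tau> \<noteq> 0" "z \<noteq> 0" "\<sigma> \<noteq> 0" "\<sigma>' \<noteq> 0" "1 - 2 * of_int b * \<tau> \<noteq> 0" "\<tau> + of_int b' \<noteq> 0"
    using \<tau> z \<sigma> by (auto simp: complex_eq_iff)
  define d where "d = 1 - 2 * of_int b * \<tau>"
  have d: "d \<noteq> 0" using nz by (simp add: d_def)
  have z_eq: "z = - d / (10 * \<tau>)"
    using nz by (simp add: z_def d_def field_simps)
  have \<rho>_eq: "\<rho> = 5 * \<tau> / d"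
    using nz d by (simp add: \<rho>_def z_eq)
  have "\<sigma> * d = 5 * \<tau> + of_int b' * d"
    using d by (simp add: \<sigma>_def \<rho>_eq distrib_right)
  also have "of_int b' * d = of_int b' - 2 * (of_int b * of_int b') * \<tau>"
    by (simp add: d_def algebra_simps)
  finally have \<sigma>_eq: "\<sigma> = (\<tau> + of_int b') / d"
    unfolding bb using d by (simp add: eq_divide_eq)
  have W\<sigma>: "-1 / (2 * \<sigma>) = -1 / (2 * \<sigma>') + of_int b"
  proof -
    define T where "T = \<tau> + of_int b'"
    have T: "T \<noteq> 0" using nz by (simp add: T_def)
    have "- d = 2 * of_int b * T - 5"
      using bb by (simp add: d_def T_def algebra_simps)
    hence "- d / (2 * T) = (2 * of_int b * T - 5) / (2 * T)"
      by (simp only:)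
    also have "\<dots> = - (5 / (2 * T)) + of_int b"
      using T by (simp add: diff_divide_distrib)
    finally show ?thesis
      by (simp add: \<sigma>_eq \<sigma>'_def flip: T_def)
  qed
  have "C * \<sigma> ^ k * G \<sigma> = F (-1 / (2 * \<sigma>))"
    using inv[OF \<sigma>(1)] by simp
  also have "\<dots> = qexp (of_int (b * N) / 24) * (C * \<sigma>' ^ k * G \<sigma>')"
    unfolding W\<sigma> using F[OF \<sigma>''] inv[OF \<sigma>(2)] by simp
  finally have 1: "\<sigma> ^ k * G \<sigma> = qexp (of_int (b * N) / 24) * (\<sigma>' ^ k * G \<sigma>')"
    using C by simp
  have 2: "G \<sigma> = qexp (of_int (b' * N') / 24) * G \<rho>"
    unfolding \<sigma>_def by (rule G[OF \<rho>])
  have 3: "F z = C * \<rho> ^ k * G \<rho>"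
    using inv[OF \<rho>] nz by (simp add: \<rho>_def)
  \<comment> \<open>By this relation the weight factors along the chain collapse to
    \<open>\<tau> ^ k\<close>.\<close>
  have 4: "\<rho> * \<sigma>' = \<tau> * \<sigma>"
    using nz by (simp add: \<rho>_eq \<sigma>'_def \<sigma>_eq)
  have "\<sigma> ^ k * (qexp (of_int (b' * N') / 24) * F z) = C * \<rho> ^ k * (\<sigma> ^ k * G \<sigma>)"
    unfolding 2 3 by simp
  also have "\<dots> = C * (\<rho> * \<sigma>') ^ k * qexp (of_int (b * N) / 24) * G \<sigma>'"
    unfolding 1 by (simp add: power_mult_distrib)
  also have "\<dots> = \<sigma> ^ k * (C * \<tau> ^ k * qexp (of_int (b * N) / 24) * G \<sigma>')"
    unfolding 4 by (simp add: power_mult_distrib)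
  finally have "qexp (of_int (b' * N') / 24) * F z = C * \<tau> ^ k * qexp (of_int (b * N) / 24) * G \<sigma>'"
    using nz by simp
  hence "F z = C * \<tau> ^ k * (qexp (of_int (b * N) / 24) / qexp (of_int (b' * N') / 24) * G \<sigma>')"
    by (simp add: field_simps)
  also have "qexp (of_int (b * N) / 24) / qexp (of_int (b' * N') / 24) = qexp (of_int (b * N - b' * N') / 24)"
    by (simp add: diff_divide_distrib qexp_diff)
  finally show ?thesis
    by (simp only: z_def \<sigma>'_def)
qed

text \<open>This is (-1)^x, the sign that Hecke terms with nonzero \<open>b\<close> acquire under
  inversion; the term at \<open>5 * \<tau>\<close> must carry it as well.\<close>

definition parity_sign :: "int \<Rightarrow> complex" where
  "parity_sign x = (if even x then 1 else -1)"

lemma parity_sign_qexp: "parity_sign x = qexp (of_int x / 2)"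
proof -
  have "qexp (of_int x / 2) = qexp (1 / 2) powi x"
    by (subst qexp_of_int_mult [symmetric]) simp
  thus ?thesis by (auto simp: parity_sign_def)
qed

text \<open>
  The exponent congruence behind the matching of the terms \<open>b\<close> and \<open>b'\<close> in the Hecke sum.
\<close>

lemma hecke_exponent_dvd:
  fixes x y k m m' s s' b b' :: int
  assumes "x + y = 2 * k" "x + 2 * y = m + 5 * s" "y + 2 * x = m' + 5 * s'"
  assumes "(b, b') \<in> {(1, 2), (2, 1), (-1, -2), (-2, -1)}"
  shows "24 dvd (- b * (5 * m + s) + (b * (x + 2 * y) - b' * (y + 2 * x)) - (12 * x - b' * (5 * m' + s')))"
proof -
  define t where "t = 5 * m + s"
  define t' where "t' = 5 * m' + s'"
  have N: "x + 2 * y = 5 * t - 24 * m" "y + 2 * x = 5 * t' - 24 * m'"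
    using assms(2,3) by (simp_all add: t_def t'_def)
  \<comment> \<open>With N = x + 2y and N' = y + 2x, eliminating \<open>x\<close> by 3x = 2N' - N
    leaves 24 \<open>e\<close>; for \<open>e'\<close> one uses 3y = 2N - N' and x = 2k - y. Negating
    \<open>b\<close> and \<open>b'\<close> changes the sign of all but the term 12x, whence the
    witnesses with \<open>- x\<close>.\<close>
  define e where "e = t - 2 * t' - 5 * (m - 2 * m')"
  define e' where "e' = 2 * t - t' - 5 * (2 * m - m') - k"
  consider "b = 1" "b' = 2" | "b = 2" "b' = 1" | "b = -1" "b' = -2" | "b = -2" "b' = -1"
    using assms(4) by auto
  hence "\<exists>w. - b * t + (b * (x + 2 * y) - b' * (y + 2 * x)) - (12 * x - b' * t') = 24 * w"
  proof cases
    case 1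
    thus ?thesis using N assms(1) by (intro exI[of _ e]) (simp add: e_def)
  next
    case 2
    thus ?thesis using N assms(1) by (intro exI[of _ e']) (simp add: e'_def)
  next
    case 3
    thus ?thesis using N assms(1) by (intro exI[of _ "- e - x"]) (simp add: e_def)
  next
    case 4
    thus ?thesis using N assms(1) by (intro exI[of _ "- e' - x"]) (simp add: e'_def)
  qed
  thus ?thesis unfolding t_def t'_def dvd_def .
qed

text \<open>The twist by \<open>5 * m + s\<close> compensates the fractional order, leaving exactly
  the filter for exponents congruent to \<open>m\<close> modulo 5. The order m + 5s becomes 5m + s,
  and the term at \<open>5 * \<tau>\<close> starts \<open>s\<close> integral powers later.\<close>

lemma hecke_expansion:
  fixes m s k :: nat
  assumes \<tau>: "Im \<tau> > 0" and k: "k \<ge> 1" and N: "x + 2 * y = int m + 5 * int s"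
  assumes u: "(\<Sum>b\<in>{-2..2::int}. qexp (of_int b * (- of_nat m / 5)) * etaq x y (qexp ((\<tau> + of_int b) / 5))) =
                5 * qexp (of_nat m * \<tau> / 5) * u (qexp \<tau>)"
  defines "F \<equiv> (\<lambda>\<tau>. eta \<tau> powi x * eta (2 * \<tau>) powi y)"
  shows "(\<Sum>b\<in>{-2..2::int}. qexp (- of_int (b * (5 * int m + int s)) / 24) * F ((\<tau> + of_int b) / 5)) + \<epsilon> * 5 ^ k * F (5 * \<tau>) =
           5 * qexp (of_int (5 * int m + int s) * \<tau> / 24) *
             (u (qexp \<tau>) + \<epsilon> * 5 ^ (k - 1) * qexp \<tau> ^ s * etaq x y (qexp \<tau> ^ 5))"
proof -
  have F: "F z = qexp ((of_nat m + 5 * of_nat s) * z / 24) * etaq x y (qexp z)" if "Im z > 0" for z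
    unfolding F_def eta_powi[OF that] N by simp
  have "qexp (- of_int (b * (5 * int m + int s)) / 24) * F ((\<tau> + of_int b) / 5) =
        qexp ((of_nat m + 5 * of_nat s) * \<tau> / 120) *
          (qexp (of_int b * (- of_nat m / 5)) * etaq x y (qexp ((\<tau> + of_int b) / 5)))" for b
  proof -
    have "qexp (- of_int (b * (5 * int m + int s)) / 24) * qexp ((of_nat m + 5 * of_nat s) * ((\<tau> + of_int b) / 5) / 24) =
          qexp ((of_nat m + 5 * of_nat s) * \<tau> / 120) * qexp (of_int b * (- of_nat m / 5))"
      unfolding qexp_add[symmetric] by (rule arg_cong[of _ _ qexp]) (simp add: field_simps)
    thus ?thesis using F[of "(\<tau> + of_int b) / 5"] \<tau> by (simp add: mult_ac)
  qed
  hence "(\<Sum>b\<in>{-2..2::int}. qexp (- of_int (b * (5 * int m + int s)) / 24) * F ((\<tau> + of_int b) / 5)) =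
         qexp ((of_nat m + 5 * of_nat s) * \<tau> / 120) * (5 * qexp (of_nat m * \<tau> / 5) * u (qexp \<tau>))"
    by (simp only: u flip: sum_distrib_left)
  also have "\<dots> = 5 * (qexp ((of_nat m + 5 * of_nat s) * \<tau> / 120) * qexp (of_nat m * \<tau> / 5)) * u (qexp \<tau>)"
    by (simp add: mult_ac)
  also have "qexp ((of_nat m + 5 * of_nat s) * \<tau> / 120) * qexp (of_nat m * \<tau> / 5) = qexp (of_int (5 * int m + int s) * \<tau> / 24)"
    unfolding qexp_add[symmetric] by (rule arg_cong[of _ _ qexp]) (simp add: field_simps)
  finally have 1: "(\<Sum>b\<in>{-2..2::int}. qexp (- of_int (b * (5 * int m + int s)) / 24) * F ((\<tau> + of_int b) / 5)) =
     5 * qexp (of_int (5 * int m + int s) * \<tau> / 24) * u (qexp \<tau>)" .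
  have "F (5 * \<tau>) = qexp ((of_nat m + 5 * of_nat s) * (5 * \<tau>) / 24) * etaq x y (qexp (5 * \<tau>))"
    by (rule F) (use \<tau> in simp)
  also have "qexp (5 * \<tau>) = qexp \<tau> ^ 5"
    by (rule qexp_numeral_mult)
  also have "qexp ((of_nat m + 5 * of_nat s) * (5 * \<tau>) / 24) = qexp (of_int (5 * int m + int s) * \<tau> / 24) * qexp \<tau> ^ s"
    unfolding qexp_of_nat_mult[symmetric] qexp_add[symmetric]
    by (rule arg_cong[of _ _ qexp]) (simp add: field_simps)
  finally have 2: "F (5 * \<tau>) = qexp (of_int (5 * int m + int s) * \<tau> / 24) * qexp \<tau> ^ s * etaq x y (qexp \<tau> ^ 5)" .
  have 3: "(5 :: complex) ^ k = 5 * 5 ^ (k - 1)"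
    using k by (metis Suc_diff_le diff_Suc_1 power_Suc One_nat_def Suc_pred' less_eq_Suc_le)
  show ?thesis unfolding 1 2 3 by (simp add: algebra_simps)
qed

text \<open>Inversion permutes the six terms of the Hecke sum: 1 and 2 are exchanged, likewise -1
  and -2, and \<open>b = 0\<close> trades places with the term at \<open>5 * \<tau>\<close>. So the
  image is again a form of the same weight.\<close>

lemma hecke_cusp_pair:
  fixes m m' s s' k :: nat and x y :: int
  assumes k: "k \<ge> 1" and xy: "x + y = 2 * int k"
  assumes N: "x + 2 * y = int m + 5 * int s" "y + 2 * x = int m' + 5 * int s'"
  assumes hol: "u holomorphic_on ball 0 1" "u' holomorphic_on ball 0 1"
  assumes u: "\<And>\<tau>. Im \<tau> > 0 \<Longrightarrow>
    (\<Sum>b\<in>{-2..2::int}. qexp (of_int b * (- of_nat m / 5)) * etaq x y (qexp ((\<tau> + of_int b) / 5))) =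
      5 * qexp (of_nat m * \<tau> / 5) * u (qexp \<tau>)"
  assumes u': "\<And>\<tau>. Im \<tau> > 0 \<Longrightarrow>
    (\<Sum>b\<in>{-2..2::int}. qexp (of_int b * (- of_nat m' / 5)) * etaq y x (qexp ((\<tau> + of_int b) / 5))) =
      5 * qexp (of_nat m' * \<tau> / 5) * u' (qexp \<tau>)"
  obtains p' where "cusp_pair k (5 * int m + int s) (5 * int m' + int s')
    (\<lambda>q. u q + parity_sign x * 5 ^ (k - 1) * q ^ s * etaq x y (q ^ 5)) p'"
proof -
  define F where "F = (\<lambda>\<tau>. eta \<tau> powi x * eta (2 * \<tau>) powi y)"
  define G where "G = (\<lambda>\<tau>. eta \<tau> powi y * eta (2 * \<tau>) powi x)"
  define \<epsilon> where "\<epsilon> = parity_sign x"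
  define M where "M = 5 * int m + int s"
  define M' where "M' = 5 * int m' + int s'"
  obtain C where C: "C \<noteq> 0" and inv: "\<And>\<tau>. Im \<tau> > 0 \<Longrightarrow> F (-1 / (2 * \<tau>)) = C * \<tau> ^ k * G \<tau>"
    using eta_powi_inversion[OF xy] unfolding F_def G_def by metis
  have shift: "eta (\<tau> + of_int n) powi x * eta (2 * (\<tau> + of_int n)) powi y =
               qexp (of_int (n * (x + 2 * y)) / 24) * (eta \<tau> powi x * eta (2 * \<tau>) powi y)"
    if "Im \<tau> > 0" for \<tau> n x y
  proof -
    have "Im (\<tau> + of_int n) > 0" using that by simp
    have "qexp (of_int (x + 2 * y) * (\<tau> + of_int n) / 24) =
          qexp (of_int (n * (x + 2 * y)) / 24) * qexp (of_int (x + 2 * y) * \<tau> / 24)"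
      unfolding qexp_add[symmetric] by (rule arg_cong[of _ _ qexp]) (simp add: field_simps)
    thus ?thesis
      unfolding eta_powi[OF that] eta_powi[OF \<open>Im (\<tau> + of_int n) > 0\<close>] by simp
  qed
  define R where "R = (\<lambda>\<tau>. (\<Sum>b\<in>{-2..2::int}. qexp (- of_int (b * M) / 24) * F ((\<tau> + of_int b) / 5)) + \<epsilon> * 5 ^ k * F (5 * \<tau>))"
  define R' where "R' = (\<lambda>\<tau>. (\<Sum>b\<in>{-2..2::int}. qexp (- of_int (b * M') / 24) * G ((\<tau> + of_int b) / 5)) + \<epsilon> * 5 ^ k * G (5 * \<tau>))"
  have R_eq: "R \<tau> = 5 * qexp (of_int M * \<tau> / 24) *
      (u (qexp \<tau>) + \<epsilon> * 5 ^ (k - 1) * qexp \<tau> ^ s * etaq x y (qexp \<tau> ^ 5))" if "Im \<tau> > 0" for \<tau>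
    unfolding R_def F_def M_def by (rule hecke_expansion[OF that k N(1), where u = u, OF u[OF that]])
  have R'_eq: "R' \<tau> = 5 * qexp (of_int M' * \<tau> / 24) *
      (u' (qexp \<tau>) + \<epsilon> * 5 ^ (k - 1) * qexp \<tau> ^ s' * etaq y x (qexp \<tau> ^ 5))" if "Im \<tau> > 0" for \<tau>
    unfolding R'_def G_def M'_def by (rule hecke_expansion[OF that k N(2), where u = u', OF u'[OF that]])
  have trm: "qexp (- of_int (b * M) / 24) * F ((-1 / (2 * \<tau>) + of_int b) / 5) =
             C * \<tau> ^ k * \<epsilon> * (qexp (- of_int (b' * M') / 24) * G ((\<tau> + of_int b') / 5))"
    if \<tau>: "Im \<tau> > 0" and b: "(b, b') \<in> {(1, 2), (2, 1), (-1, -2), (-2, -1)}" for b b' \<tau>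
  proof -
    have bb: "b * b' = 2" using b by auto
    have F_eq: "F ((-1 / (2 * \<tau>) + of_int b) / 5) =
          C * \<tau> ^ k * (qexp (of_int (b * (x + 2 * y) - b' * (y + 2 * x)) / 24) * G ((\<tau> + of_int b') / 5))"
      by (rule eta_powi_hecke_term[OF inv C _ _ bb \<tau>]) (use shift in \<open>simp_all add: F_def G_def\<close>)
    have "24 dvd (- b * M + (b * (x + 2 * y) - b' * (y + 2 * x)) - (12 * x - b' * M'))"
      unfolding M_def M'_def by (rule hecke_exponent_dvd[OF xy N b])
    then obtain j where "- b * M + (b * (x + 2 * y) - b' * (y + 2 * x)) - (12 * x - b' * M') = 24 * j" ..
    hence "- b * M + (b * (x + 2 * y) - b' * (y + 2 * x)) = (12 * x - b' * M') + 24 * j"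
      by linarith
    from arg_cong[OF this, of "\<lambda>n. of_int n / 24 :: complex"]
    have "- of_int (b * M) / 24 + of_int (b * (x + 2 * y) - b' * (y + 2 * x)) / 24 =
          of_int x / 2 + - of_int (b' * M') / 24 + (of_int j :: complex)"
      by (simp add: add_divide_distrib diff_divide_distrib)
    from arg_cong[OF this, of qexp]
    have "qexp (- of_int (b * M) / 24) * qexp (of_int (b * (x + 2 * y) - b' * (y + 2 * x)) / 24) =
          \<epsilon> * qexp (- of_int (b' * M') / 24)"
      by (simp only: qexp_add \<epsilon>_def parity_sign_qexp qexp_of_int mult_1_right)
    thus ?thesis unfolding F_eq by (simp add: mult_ac)
  qed
  have RW: "R (-1 / (2 * \<tau>)) = C * \<tau> ^ k * \<epsilon> * R' \<tau>" if \<tau>: "Im \<tau> > 0" for \<tau>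
  proof -
    have set: "{-2..2::int} = {-2, -1, 0, 1, 2}" by auto
    have \<epsilon>2: "\<epsilon> * \<epsilon> = 1" by (simp add: \<epsilon>_def parity_sign_def)
    \<comment> \<open>For the exchange of \<open>b = 0\<close> with the term at
      \<open>5 * \<tau>\<close>, the powers of 5 come from the weight factors of
      \<open>5 * \<tau>\<close> and \<open>\<tau> / 5\<close>.\<close>
    have "F ((-1 / (2 * \<tau>) + 0) / 5) = F (-1 / (2 * (5 * \<tau>)))" by simp
    also have "\<dots> = C * (5 * \<tau>) ^ k * G (5 * \<tau>)"
      by (rule inv) (use \<tau> in simp)
    finally have t0: "F ((-1 / (2 * \<tau>) + 0) / 5) = C * \<tau> ^ k * \<epsilon> * (\<epsilon> * 5 ^ k * G (5 * \<tau>))"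
      using \<epsilon>2 by (simp add: power_mult_distrib mult_ac)
    have "F (5 * (-1 / (2 * \<tau>))) = F (-1 / (2 * (\<tau> / 5)))" by simp
    also have "\<dots> = C * (\<tau> / 5) ^ k * G (\<tau> / 5)"
      by (rule inv) (use \<tau> in simp)
    finally have tV: "\<epsilon> * 5 ^ k * F (5 * (-1 / (2 * \<tau>))) = C * \<tau> ^ k * \<epsilon> * G ((\<tau> + 0) / 5)"
      by (simp add: power_divide)
    have "R (-1 / (2 * \<tau>)) =
        qexp (- of_int (-2 * M) / 24) * F ((-1 / (2 * \<tau>) + of_int (-2)) / 5) +
        qexp (- of_int (-1 * M) / 24) * F ((-1 / (2 * \<tau>) + of_int (-1)) / 5) +
        F ((-1 / (2 * \<tau>) + 0) / 5) +
        qexp (- of_int (1 * M) / 24) * F ((-1 / (2 * \<tau>) + of_int 1) / 5) +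
        qexp (- of_int (2 * M) / 24) * F ((-1 / (2 * \<tau>) + of_int 2) / 5) +
        \<epsilon> * 5 ^ k * F (5 * (-1 / (2 * \<tau>)))"
      unfolding R_def set by (simp add: add_ac)
    also have "\<dots> = C * \<tau> ^ k * \<epsilon> *
       (qexp (- of_int (-1 * M') / 24) * G ((\<tau> + of_int (-1)) / 5) +
        qexp (- of_int (-2 * M') / 24) * G ((\<tau> + of_int (-2)) / 5) +
        \<epsilon> * 5 ^ k * G (5 * \<tau>) +
        qexp (- of_int (2 * M') / 24) * G ((\<tau> + of_int 2) / 5) +
        qexp (- of_int (1 * M') / 24) * G ((\<tau> + of_int 1) / 5) +
        G ((\<tau> + 0) / 5))"
      unfolding tV t0
      by (subst trm[OF \<tau>, of "-2" "-1"], simp, subst trm[OF \<tau>, of "-1" "-2"], simp,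
          subst trm[OF \<tau>, of "1" "2"], simp, subst trm[OF \<tau>, of "2" "1"], simp)
         (simp only: distrib_left)
    also have "\<dots> = C * \<tau> ^ k * \<epsilon> * R' \<tau>"
      unfolding R'_def set by (simp add: add_ac)
    finally show ?thesis .
  qed
  have "cusp_pair k M M' (\<lambda>q. u q + \<epsilon> * 5 ^ (k - 1) * q ^ s * etaq x y (q ^ 5))
          (\<lambda>q. C * \<epsilon> * (u' q + \<epsilon> * 5 ^ (k - 1) * q ^ s' * etaq y x (q ^ 5)))"
    unfolding cusp_pair_def
  proof (intro conjI allI impI)
    have pw: "norm (q ^ 5) < 1" if "q \<in> ball 0 1" for q :: complex
      using that by (simp add: norm_power power_less_one_iff)
    show "(\<lambda>q. u q + \<epsilon> * 5 ^ (k - 1) * q ^ s * etaq x y (q ^ 5)) holomorphic_on ball 0 1"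
         "(\<lambda>q. C * \<epsilon> * (u' q + \<epsilon> * 5 ^ (k - 1) * q ^ s' * etaq y x (q ^ 5))) holomorphic_on ball 0 1"
      by (intro holomorphic_intros holomorphic_on_etaq hol pw; assumption)+
    fix \<tau> :: complex assume \<tau>: "Im \<tau> > 0"
    have \<tau>': "Im (-1 / (2 * \<tau>)) > 0"
      by (rule Im_minus_inverse_pos) (use \<tau> in simp)
    show "qexp (of_int M * (-1 / (2 * \<tau>)) / 24) *
            (u (qexp (-1 / (2 * \<tau>))) + \<epsilon> * 5 ^ (k - 1) * qexp (-1 / (2 * \<tau>)) ^ s * etaq x y (qexp (-1 / (2 * \<tau>)) ^ 5)) =
          \<tau> ^ k * (qexp (of_int M' * \<tau> / 24) *
            (C * \<epsilon> * (u' (qexp \<tau>) + \<epsilon> * 5 ^ (k - 1) * qexp \<tau> ^ s' * etaq y x (qexp \<tau> ^ 5))))"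
      using RW[OF \<tau>] unfolding R_eq[OF \<tau>'] R'_eq[OF \<tau>] by simp
  qed
  thus ?thesis using that unfolding M_def M'_def \<epsilon>_def by blast
qed

section \<open>Integer power series and functions on the unit disc\<close>

text \<open>This links coefficients, on which congruences live, with functions on the disc, on which
  modularity lives.\<close>

definition represents :: "int fps \<Rightarrow> (complex \<Rightarrow> complex) \<Rightarrow> bool" where
  "represents A f \<longleftrightarrow> (\<forall>q. norm q < 1 \<longrightarrow> (\<lambda>n. of_int (fps_nth A n) * q ^ n) sums f q)"

lemma representsD: "represents A f \<Longrightarrow> norm q < 1 \<Longrightarrow> (\<lambda>n. of_int (fps_nth A n) * q ^ n) sums f q"
  by (simp add: represents_def)

lemma represents_cong: "represents A f \<Longrightarrow> (\<And>q. norm q < 1 \<Longrightarrow> f q = g q) \<Longrightarrow> represents A g"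
  by (simp add: represents_def)

lemma represents_nth:
  assumes "represents A f"
  shows "of_int (fps_nth A n) = (deriv ^^ n) f 0 / fact n"
proof -
  have "f has_fps_expansion Abs_fps (\<lambda>n. of_int (fps_nth A n))"
  proof (rule has_fps_expansionI)
    have "eventually (\<lambda>q. q \<in> ball (0::complex) 1) (nhds 0)"
      by (intro eventually_nhds_in_open) auto
    thus "\<forall>\<^sub>F q in nhds 0. (\<lambda>n. fps_nth (Abs_fps (\<lambda>n. of_int (fps_nth A n))) n * q ^ n) sums f q"
      by eventually_elim (use assms in \<open>simp add: represents_def\<close>)
  qed
  from fps_nth_fps_expansion[OF this, of n] show ?thesis by simp
qed

lemma represents_unique: "represents A f \<Longrightarrow> represents B f \<Longrightarrow> A = B"
  using represents_nth[of A f] represents_nth[of B f] by (metis fps_ext of_int_eq_iff)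

lemma represents_at_0: "represents A f \<Longrightarrow> f 0 = of_int (fps_nth A 0)"
  using represents_nth[of A f 0] by simp

lemma represents_holomorphic: "represents A f \<Longrightarrow> f holomorphic_on ball 0 1"
  by (rule power_series_holomorphic[of 0 1 "\<lambda>n. of_int (fps_nth A n)"]) (auto simp: represents_def)

lemma represents_summable_norm:
  fixes q :: complex
  assumes "represents A f" "norm q < 1"
  shows "summable (\<lambda>n. norm (of_int (fps_nth A n) * q ^ n))"
proof -
  define r where "r = (1 + norm q) / 2"
  have "norm (complex_of_real r) < 1" "norm q < norm (complex_of_real r)"
    using assms(2) unfolding norm_of_real by (auto simp: r_def)
  thus ?thesis
    by (intro powser_insidea[of _ "of_real r"] sums_summable[OF representsD[OF assms(1)]])
qed

lemma represents_const: "represents (fps_const c) (\<lambda>_. of_int c)"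
  unfolding represents_def
proof safe
  fix q :: complex
  have "(\<lambda>n. of_int (fps_nth (fps_const c) n) * q ^ n) sums (\<Sum>n\<in>{0}. of_int (fps_nth (fps_const c) n) * q ^ n)"
    by (rule sums_finite) auto
  thus "(\<lambda>n. of_int (fps_nth (fps_const c) n) * q ^ n) sums of_int c" by simp
qed

lemma represents_X_power: "represents (fps_X ^ k) (\<lambda>q. q ^ k)"
  unfolding represents_def
proof safe
  fix q :: complex
  have "(\<lambda>n. of_int (fps_nth (fps_X ^ k) n) * q ^ n) sums (\<Sum>n\<in>{k}. of_int (fps_nth (fps_X ^ k) n) * q ^ n)"
    by (rule sums_finite) auto
  thus "(\<lambda>n. of_int (fps_nth (fps_X ^ k) n) * q ^ n) sums q ^ k" by simp
qed

lemma represents_add: "represents A f \<Longrightarrow> represents B g \<Longrightarrow> represents (A + B) (\<lambda>q. f q + g q)"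
  by (auto simp: represents_def ring_distribs intro!: sums_add)

lemma represents_diff: "represents A f \<Longrightarrow> represents B g \<Longrightarrow> represents (A - B) (\<lambda>q. f q - g q)"
  by (auto simp: represents_def ring_distribs intro!: sums_diff)

lemma represents_mult:
  assumes "represents A f" "represents B g"
  shows "represents (A * B) (\<lambda>q. f q * g q)"
  unfolding represents_def
proof safe
  fix q :: complex assume q: "norm q < 1"
  have "(\<lambda>n. \<Sum>i\<le>n. (of_int (fps_nth A i) * q ^ i) * (of_int (fps_nth B (n - i)) * q ^ (n - i))) sums
          ((\<Sum>n. of_int (fps_nth A n) * q ^ n) * (\<Sum>n. of_int (fps_nth B n) * q ^ n))"
    by (rule Cauchy_product_sums) (use assms q in \<open>auto intro: represents_summable_norm\<close>)
  also have "(\<lambda>n. \<Sum>i\<le>n. (of_int (fps_nth A i) * q ^ i) * (of_int (fps_nth B (n - i)) * q ^ (n - i))) =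
             (\<lambda>n. of_int (fps_nth (A * B) n) * q ^ n)"
    unfolding fps_mult_nth of_int_sum sum_distrib_right atLeast0AtMost
    by (intro ext sum.cong) (simp_all add: mult_ac flip: power_add)
  finally show "(\<lambda>n. of_int (fps_nth (A * B) n) * q ^ n) sums (f q * g q)"
    using assms q by (simp add: represents_def sums_iff)
qed

lemma represents_exists:
  assumes "f holomorphic_on ball 0 1" "f has_fps_expansion F" "int_coeffs F"
  shows "\<exists>A. represents A f"
proof -
  have "\<forall>n. \<exists>m :: int. (deriv ^^ n) f 0 / fact n = of_int m"
    using fps_nth_fps_expansion[OF assms(2)] assms(3) unfolding int_coeffs_def Ints_def by force
  then obtain a :: "nat \<Rightarrow> int" where a: "\<And>n. (deriv ^^ n) f 0 / fact n = of_int (a n)"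
    by metis
  have "(\<lambda>n. of_int (a n) * q ^ n) sums f q" if "norm q < 1" for q
    using holomorphic_power_series[OF assms(1), of q] that a by simp
  hence "represents (Abs_fps a) f" by (simp add: represents_def)
  thus ?thesis ..
qed

section \<open>Dilation by five and extraction of residue classes\<close>

definition dilate5 :: "int fps \<Rightarrow> int fps" where
  "dilate5 A = fps_compose A (fps_X ^ 5)"

lemma dilate5_nth: "fps_nth (dilate5 A) n = (if 5 dvd n then fps_nth A (n div 5) else 0)"
  by (simp add: dilate5_def fps_nth_compose_X_power)

lemma dilate5_mult: "dilate5 (A * B) = dilate5 A * dilate5 B"
  by (simp add: dilate5_def fps_compose_mult_distrib)

lemma represents_dilate5:
  assumes "represents A f"
  shows "represents (dilate5 A) (\<lambda>q. f (q ^ 5))"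
  unfolding represents_def
proof safe
  fix q :: complex assume "norm q < 1"
  hence "norm (q ^ 5) < 1" by (simp add: norm_power power_less_one_iff)
  from representsD[OF assms this]
  have "(\<lambda>n. of_int (fps_nth (dilate5 A) (5 * n)) * q ^ (5 * n)) sums f (q ^ 5)"
    by (simp add: dilate5_nth power_mult)
  thus "(\<lambda>n. of_int (fps_nth (dilate5 A) n) * q ^ n) sums f (q ^ 5)"
    by (subst (asm) sums_mono_reindex) (auto simp: strict_mono_def dilate5_nth)
qed

definition section5 :: "nat \<Rightarrow> int fps \<Rightarrow> int fps" where
  "section5 m A = Abs_fps (\<lambda>n. fps_nth A (5 * n + m))"

lemma section5_nth [simp]: "fps_nth (section5 m A) n = fps_nth A (5 * n + m)"
  by (simp add: section5_def)

lemma section5_add: "section5 m (A + B) = section5 m A + section5 m B"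
  by (simp add: fps_eq_iff)

lemma section5_diff: "section5 m (A - B) = section5 m A - section5 m B"
  by (simp add: fps_eq_iff)

lemma section5_const_mult: "section5 m (fps_const c * A) = fps_const c * section5 m A"
  by (simp add: fps_eq_iff)

lemma section5_X_mult: "section5 (Suc m) (fps_X * A) = section5 m A"
  by (simp add: fps_eq_iff)

text \<open>Only indices \<open>5 * j\<close> of the dilated factor contribute to the convolution,
  and \<open>m < 5\<close> bounds \<open>j\<close> by \<open>n\<close>.\<close>

lemma section5_dilate5_mult:
  assumes "m < 5"
  shows "section5 m (dilate5 B * A) = B * section5 m A"
proof (rule fps_ext)
  fix n
  have "fps_nth (section5 m (dilate5 B * A)) n =
        (\<Sum>i=0..5 * n + m. fps_nth (dilate5 B) i * fps_nth A (5 * n + m - i))"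
    by (simp add: fps_mult_nth)
  also have "\<dots> = (\<Sum>i\<in>(\<lambda>j. 5 * j) ` {0..n}. fps_nth (dilate5 B) i * fps_nth A (5 * n + m - i))"
  proof (rule sum.mono_neutral_right)
    show "\<forall>i\<in>{0..5 * n + m} - (\<lambda>j. 5 * j) ` {0..n}. fps_nth (dilate5 B) i * fps_nth A (5 * n + m - i) = 0"
      using assms by (auto simp: dilate5_nth elim!: dvdE)
  qed auto
  also have "\<dots> = (\<Sum>j=0..n. fps_nth B j * fps_nth A (5 * n + m - 5 * j))"
    by (subst sum.reindex) (auto simp: inj_on_def dilate5_nth)
  also have "\<dots> = (\<Sum>j=0..n. fps_nth B j * fps_nth A (5 * (n - j) + m))"
    by (intro sum.cong) (auto simp: diff_mult_distrib2)
  finally show "fps_nth (section5 m (dilate5 B * A)) n = fps_nth (B * section5 m A) n"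
    by (simp add: fps_mult_nth)
qed

text \<open>Orthogonality of the fifth roots of unity. The symmetric residues fit the Hecke sum,
  which pairs them by the integer equation \<open>b * b' = 2\<close>.\<close>

lemma sum_fifth_roots:
  "(\<Sum>b\<in>{-2..2::int}. qexp (of_int b * (of_int j / 5))) = (if 5 dvd j then 5 else 0)"
proof -
  define w where "w = qexp (of_int j / 5)"
  have w0: "w \<noteq> 0" by (simp add: w_def)
  have w5: "w ^ 5 = 1"
    using qexp_numeral_mult[of "num.Bit1 (num.Bit0 num.One)" "of_int j / 5"] by (simp add: w_def)
  have set: "{-2..2::int} = {-2, -1, 0, 1, 2}" by auto
  have "(\<Sum>b\<in>{-2..2::int}. qexp (of_int b * (of_int j / 5))) = (\<Sum>b\<in>{-2..2::int}. w powi b)"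
    by (simp only: qexp_of_int_mult w_def)
  \<comment> \<open>The factor \<open>w ^ 2\<close> shifts the exponents from -2..2 to 0..4.\<close>
  also have "w ^ 2 * \<dots> = 1 + w + w ^ 2 + w ^ 3 + w ^ 4"
    unfolding set using w0 by (simp add: power_int_minus field_simps eval_nat_numeral)
  finally have *: "w ^ 2 * (\<Sum>b\<in>{-2..2::int}. qexp (of_int b * (of_int j / 5))) = 1 + w + w ^ 2 + w ^ 3 + w ^ 4" .
  show ?thesis
  proof (cases "5 dvd j")
    case True
    then obtain i where i: "j = 5 * i" by blast
    hence "w = 1" by (simp add: w_def)
    thus ?thesis using * True by simp
  next
    case False
    have "w \<noteq> 1"
    proof
      assume "w = 1"
      then obtain i :: int where "of_int j / 5 = (of_int i :: complex)"
        by (auto simp: w_def qexp_eq_1_iff elim: Ints_cases)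
      hence "of_int j = (of_int (5 * i) :: complex)" by (simp add: field_simps)
      hence "j = 5 * i" by (simp only: of_int_eq_iff)
      thus False using False by simp
    qed
    moreover have "(w - 1) * (1 + w + w ^ 2 + w ^ 3 + w ^ 4) = w ^ 5 - 1"
      by (simp add: algebra_simps eval_nat_numeral)
    ultimately have "1 + w + w ^ 2 + w ^ 3 + w ^ 4 = 0" using w5 by simp
    thus ?thesis using * w0 False by simp
  qed
qed

text \<open>Averaging over the points \<open>(\<tau> + b) / 5\<close> filters the coefficients. The
  same computation proves convergence of the extracted series, since every nonzero \<open>q\<close>
  in the disc is some \<open>qexp \<tau>\<close>.\<close>

lemma represents_section5:
  assumes A: "represents A f" and m: "m < 5"
  obtains u where "represents (section5 m A) u"
    "\<And>\<tau>. Im \<tau> > 0 \<Longrightarrow> (\<Sum>b\<in>{-2..2::int}. qexp (of_int b * (- of_nat m / 5)) * f (qexp ((\<tau> + of_int b) / 5))) =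
            5 * qexp (of_nat m * \<tau> / 5) * u (qexp \<tau>)"
proof -
  define S where "S = (\<lambda>\<tau>. \<Sum>b\<in>{-2..2::int}. qexp (of_int b * (- of_nat m / 5)) * f (qexp ((\<tau> + of_int b) / 5)))"
  have sums: "(\<lambda>n. of_int (fps_nth (section5 m A) n) * qexp \<tau> ^ n) sums (S \<tau> / (5 * qexp (of_nat m * \<tau> / 5)))"
    if \<tau>: "Im \<tau> > 0" for \<tau>
  proof -
    have "(\<lambda>n. \<Sum>b\<in>{-2..2::int}. qexp (of_int b * (- of_nat m / 5)) *
             (of_int (fps_nth A n) * qexp ((\<tau> + of_int b) / 5) ^ n)) sums S \<tau>"
      unfolding S_def
      by (intro sums_sum sums_mult representsD[OF A]) (use \<tau> in \<open>simp add: norm_qexp_less_1\<close>)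
    also have "(\<lambda>n. \<Sum>b\<in>{-2..2::int}. qexp (of_int b * (- of_nat m / 5)) *
             (of_int (fps_nth A n) * qexp ((\<tau> + of_int b) / 5) ^ n)) =
          (\<lambda>n. of_int (fps_nth A n) * qexp (of_nat n * \<tau> / 5) * (if 5 dvd (int n - int m) then 5 else 0))"
    proof (rule ext)
      fix n
      have *: "qexp (of_int b * (- of_nat m / 5)) * qexp ((\<tau> + of_int b) / 5) ^ n =
            qexp (of_nat n * \<tau> / 5) * qexp (of_int b * (of_int (int n - int m) / 5))" for b
        unfolding qexp_of_nat_mult[symmetric] qexp_add[symmetric]
        by (rule arg_cong[of _ _ qexp]) (simp add: field_simps)
      show "(\<Sum>b\<in>{-2..2::int}. qexp (of_int b * (- of_nat m / 5)) *
             (of_int (fps_nth A n) * qexp ((\<tau> + of_int b) / 5) ^ n)) =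
            of_int (fps_nth A n) * qexp (of_nat n * \<tau> / 5) * (if 5 dvd (int n - int m) then 5 else 0)"
        unfolding sum_fifth_roots[symmetric] sum_distrib_left mult.assoc *[symmetric]
        by (simp only: mult.left_commute)
    qed
    finally have "(\<lambda>l. of_int (fps_nth A (5 * l + m)) * qexp (of_nat (5 * l + m) * \<tau> / 5) *
        (if 5 dvd (int (5 * l + m) - int m) then 5 else 0)) sums S \<tau>"
    proof (subst sums_mono_reindex[of "\<lambda>l. 5 * l + m"])
      fix n assume n: "n \<notin> range (\<lambda>l. 5 * l + m)"
      have "\<not> 5 dvd (int n - int m)"
      proof
        assume "5 dvd (int n - int m)"
        then obtain j where j: "int n - int m = 5 * j" by blast
        \<comment> \<open>Since n - m > -5, a multiple of 5 equal to it cannot be negative.\<close>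
        have "j \<ge> 0" using j m by linarith
        hence "n = 5 * nat j + m" using j by linarith
        thus False using n by blast
      qed
      thus "of_int (fps_nth A n) * qexp (of_nat n * \<tau> / 5) * (if 5 dvd (int n - int m) then 5 else 0) = 0"
        by simp
    qed (auto simp: strict_mono_def)
    also have "(\<lambda>l. of_int (fps_nth A (5 * l + m)) * qexp (of_nat (5 * l + m) * \<tau> / 5) *
        (if 5 dvd (int (5 * l + m) - int m) then 5 else 0)) =
      (\<lambda>l. of_int (fps_nth (section5 m A) l) * qexp \<tau> ^ l * (5 * qexp (of_nat m * \<tau> / 5)))"
    proof (rule ext)
      fix l
      have "qexp (of_nat (5 * l + m) * \<tau> / 5) = qexp \<tau> ^ l * qexp (of_nat m * \<tau> / 5)"
        unfolding qexp_of_nat_mult[symmetric] qexp_add[symmetric]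
        by (rule arg_cong[of _ _ qexp]) (simp add: field_simps)
      thus "of_int (fps_nth A (5 * l + m)) * qexp (of_nat (5 * l + m) * \<tau> / 5) *
        (if 5 dvd (int (5 * l + m) - int m) then 5 else 0) =
         of_int (fps_nth (section5 m A) l) * qexp \<tau> ^ l * (5 * qexp (of_nat m * \<tau> / 5))"
        by simp
    qed
    finally show ?thesis
      using sums_divide[of _ "S \<tau>" "5 * qexp (of_nat m * \<tau> / 5)"] by fastforce
  qed
  define u where "u = (\<lambda>q. \<Sum>n. of_int (fps_nth (section5 m A) n) * q ^ n :: complex)"
  have "represents (section5 m A) u"
    unfolding represents_def
  proof safe
    fix q :: complex assume q: "norm q < 1"
    have "summable (\<lambda>n. of_int (fps_nth (section5 m A) n) * q ^ n)"
    proof (cases "q = 0")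
      case True
      thus ?thesis by (auto intro: summable_finite[of "{0}"])
    next
      case False
      then obtain \<tau> where "q = qexp \<tau>" using qexp_surj by metis
      thus ?thesis using sums[of \<tau>] q by (auto simp: norm_qexp_less_1 sums_iff)
    qed
    thus "(\<lambda>n. of_int (fps_nth (section5 m A) n) * q ^ n) sums u q"
      unfolding u_def by (rule summable_sums)
  qed
  moreover have "S \<tau> = 5 * qexp (of_nat m * \<tau> / 5) * u (qexp \<tau>)" if "Im \<tau> > 0" for \<tau>
    using sums_unique[OF sums[OF that]] by (simp add: u_def divide_eq_eq mult_ac)
  ultimately show ?thesis using that[of u] unfolding S_def by blast
qed

section \<open>Integer expansions of eta quotients\<close>

lemma powi_fps_expansion:
  assumes "f has_fps_expansion F" "int_coeffs F" "fps_nth F 0 = 1"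
  obtains G where "(\<lambda>q. f q powi x) has_fps_expansion G" "int_coeffs G"
proof (cases "x \<ge> 0")
  case True
  have "(\<lambda>q. f q powi x) has_fps_expansion F ^ nat x"
    using True by (simp add: power_int_def has_fps_expansion_power assms)
  thus ?thesis using that int_coeffs_power[OF assms(2)] by blast
next
  case False
  have "(\<lambda>q. inverse (f q) ^ nat (- x)) has_fps_expansion inverse F ^ nat (- x)"
    by (intro has_fps_expansion_power has_fps_expansion_inverse assms) (simp add: assms)
  hence "(\<lambda>q. f q powi x) has_fps_expansion inverse F ^ nat (- x)"
    using False by (simp add: power_int_def)
  thus ?thesis using that int_coeffs_power[OF int_coeffs_inverse[OF assms(2,3)]] by blast
qed

text \<open>The description is legitimate: uniqueness is \<open>represents_unique\<close>, and
  existence, by integrality of the expansion, is shown in \<open>represents_etaq\<close>.\<close>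

definition etaq_fps :: "int \<Rightarrow> int \<Rightarrow> int fps" where
  "etaq_fps x y = (THE A. represents A (etaq x y))"

lemma represents_etaq: "represents (etaq_fps x y) (etaq x y)"
proof -
  obtain D where D: "(\<lambda>q. qpoch (q ^ 1) (q ^ 1)) has_fps_expansion D" "int_coeffs D" "fps_nth D 0 = 1"
    using qpoch_fps[of 1] by auto
  obtain E where E: "(\<lambda>q. qpoch (q ^ 2) (q ^ 2)) has_fps_expansion E" "int_coeffs E" "fps_nth E 0 = 1"
    using qpoch_fps[of 2] by auto
  obtain D' where D': "(\<lambda>q. qpoch (q ^ 1) (q ^ 1) powi x) has_fps_expansion D'" "int_coeffs D'"
    using powi_fps_expansion[OF D] by blast
  obtain E' where E': "(\<lambda>q. qpoch (q ^ 2) (q ^ 2) powi y) has_fps_expansion E'" "int_coeffs E'"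
    using powi_fps_expansion[OF E] by blast
  have "etaq x y has_fps_expansion D' * E'"
    using has_fps_expansion_mult[OF D'(1) E'(1)] by (simp add: etaq_def [abs_def])
  moreover have "etaq x y holomorphic_on ball 0 1"
    by (intro holomorphic_on_etaq holomorphic_intros) auto
  ultimately have "\<exists>A. represents A (etaq x y)"
    using represents_exists int_coeffs_mult[OF D'(2) E'(2)] by blast
  thus ?thesis
    unfolding etaq_fps_def using represents_unique by (metis theI)
qed

lemma etaq_fps_mult: "etaq_fps x y * etaq_fps x' y' = etaq_fps (x + x') (y + y')"
proof (rule represents_unique)
  show "represents (etaq_fps x y * etaq_fps x' y') (\<lambda>q. etaq x y q * etaq x' y' q)"
    by (intro represents_mult represents_etaq)
  show "represents (etaq_fps (x + x') (y + y')) (\<lambda>q. etaq x y q * etaq x' y' q)"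
    by (rule represents_cong[OF represents_etaq]) (simp add: etaq_add)
qed

lemma etaq_fps_mult_left: "etaq_fps x y * (etaq_fps x' y' * A) = etaq_fps (x + x') (y + y') * A"
  by (simp add: etaq_fps_mult flip: mult.assoc)

lemma etaq_fps_0_0 [simp]: "etaq_fps 0 0 = 1"
proof (rule represents_unique[OF represents_etaq])
  show "represents 1 (etaq 0 0)"
    by (rule represents_cong[of 1 "\<lambda>_. 1"]) (use represents_const[of 1] in \<open>simp_all add: etaq_def\<close>)
qed

lemma etaq_fps_nth_0 [simp]: "fps_nth (etaq_fps x y) 0 = 1"
  using represents_at_0[OF represents_etaq[of x y]] by simp

section \<open>Congruences of power series\<close>

definition fps_cong :: "int \<Rightarrow> int fps \<Rightarrow> int fps \<Rightarrow> bool" where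
  "fps_cong c A B \<longleftrightarrow> (\<forall>n. c dvd fps_nth A n - fps_nth B n)"

lemma fps_cong_iff: "fps_cong c A B \<longleftrightarrow> (\<exists>C. A - B = fps_const c * C)"
proof
  assume *: "fps_cong c A B"
  have "A - B = fps_const c * Abs_fps (\<lambda>n. (fps_nth A n - fps_nth B n) div c)"
    using * by (auto simp: fps_eq_iff fps_cong_def)
  thus "\<exists>C. A - B = fps_const c * C" ..
next
  assume "\<exists>C. A - B = fps_const c * C"
  then obtain C where "A - B = fps_const c * C" ..
  hence "fps_nth A n - fps_nth B n = c * fps_nth C n" for n
    by (metis fps_mult_left_const_nth fps_sub_nth)
  thus "fps_cong c A B" by (simp add: fps_cong_def)
qed

lemma fps_cong_refl [simp]: "fps_cong c A A"
  by (simp add: fps_cong_def)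

lemma fps_cong_sym: "fps_cong c A B \<Longrightarrow> fps_cong c B A"
  by (simp add: fps_cong_def dvd_diff_commute)

lemma fps_cong_trans [trans]:
  assumes "fps_cong c A B" "fps_cong c B D"
  shows "fps_cong c A D"
  unfolding fps_cong_def
proof
  fix n
  have "c dvd (fps_nth A n - fps_nth B n) + (fps_nth B n - fps_nth D n)"
    using assms unfolding fps_cong_def by (meson dvd_add)
  thus "c dvd fps_nth A n - fps_nth D n" by simp
qed

lemma fps_cong_diff:
  assumes "fps_cong c A B" "fps_cong c A' B'"
  shows "fps_cong c (A - A') (B - B')"
  unfolding fps_cong_def
proof
  fix n
  have "c dvd (fps_nth A n - fps_nth B n) - (fps_nth A' n - fps_nth B' n)"
    using assms unfolding fps_cong_def by (meson dvd_diff)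
  thus "c dvd fps_nth (A - A') n - fps_nth (B - B') n" by (simp add: algebra_simps)
qed

lemma fps_cong_add:
  assumes "fps_cong c A B" "fps_cong c A' B'"
  shows "fps_cong c (A + A') (B + B')"
  unfolding fps_cong_def
proof
  fix n
  have "c dvd (fps_nth A n - fps_nth B n) + (fps_nth A' n - fps_nth B' n)"
    using assms unfolding fps_cong_def by (meson dvd_add)
  thus "c dvd fps_nth (A + A') n - fps_nth (B + B') n" by (simp add: algebra_simps)
qed

lemma fps_cong_mult_left: "fps_cong c A B \<Longrightarrow> fps_cong c (D * A) (D * B)"
  unfolding fps_cong_iff by (metis mult.left_commute right_diff_distrib)

lemma fps_cong_mult: "fps_cong c A B \<Longrightarrow> fps_cong c A' B' \<Longrightarrow> fps_cong c (A * A') (B * B')"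
  using fps_cong_mult_left[of c A' B' A] fps_cong_mult_left[of c A B B']
  by (metis fps_cong_trans mult.commute)

lemma fps_cong_dvd: "fps_cong c A B \<Longrightarrow> d dvd c \<Longrightarrow> fps_cong d A B"
  unfolding fps_cong_def by (meson dvd_trans)

lemma fps_cong_section5: "fps_cong c A B \<Longrightarrow> fps_cong c (section5 m A) (section5 m B)"
  by (simp add: fps_cong_def)

section \<open>The fifth power of the Euler product modulo five\<close>

definition euler_prod :: "nat \<Rightarrow> nat \<Rightarrow> int fps" where
  "euler_prod k N = (\<Prod>n<N. 1 - fps_X ^ (k * Suc n))"

text \<open>Factor by factor, (1 - Y)^5 is congruent to 1 - Y^5, and dilation sends a power Y of the
  variable to Y^5.\<close>

lemma euler_prod_frobenius: "fps_cong 5 (euler_prod k N ^ 5) (dilate5 (euler_prod k N))"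
proof (induction N)
  case 0
  thus ?case by (simp add: euler_prod_def dilate5_def)
next
  case (Suc N)
  have "fps_cong 5 ((1 - fps_X ^ j) ^ 5) (dilate5 (1 - fps_X ^ j))" for j
  proof -
    define Y :: "int fps" where "Y = fps_X ^ j"
    have "dilate5 (1 - Y) = 1 - Y ^ 5"
      unfolding dilate5_def Y_def fps_compose_sub_distrib
      by (simp add: fps_X_power_compose mult.commute flip: power_mult)
    moreover have "(1 - Y) ^ 5 - (1 - Y ^ 5) = 5 * (- Y + 2 * Y ^ 2 - 2 * Y ^ 3 + Y ^ 4)"
      by (simp add: eval_nat_numeral algebra_simps)
    hence "fps_cong 5 ((1 - Y) ^ 5) (1 - Y ^ 5)"
      unfolding fps_cong_iff numeral_fps_const by blast
    ultimately show ?thesis by (simp add: Y_def)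
  qed
  from fps_cong_mult[OF Suc this[of "k * Suc N"]] show ?case
    by (simp add: euler_prod_def power_mult_distrib dilate5_mult)
qed

lemma represents_euler_prod:
  "represents (euler_prod k N) (\<lambda>q. \<Prod>n<N. 1 - q ^ k * (q ^ k) ^ n)"
proof (induction N)
  case 0
  show ?case using represents_const[of 1] by (simp add: euler_prod_def)
next
  case (Suc N)
  have "represents (1 - fps_X ^ (k * Suc N)) (\<lambda>q. 1 - q ^ k * (q ^ k) ^ N)"
    using represents_diff[OF represents_const[of 1] represents_X_power[of "k * Suc N"]]
    by (simp add: power_add flip: power_mult)
  from represents_mult[OF Suc this] show ?case
    by (simp add: euler_prod_def)
qed

lemma euler_prod_nth_stable:
  assumes "k \<ge> 1" "m \<le> N"
  shows "fps_nth (euler_prod k (N + j)) m = fps_nth (euler_prod k N) m"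
proof (induction j)
  case (Suc j)
  have "k * Suc (N + j) > m"
    using assms by (metis le_add1 le_trans less_Suc_eq_le mult_1 mult_le_mono1 order_less_le_trans)
  hence "fps_nth (euler_prod k (N + Suc j)) m = fps_nth (euler_prod k (N + j)) m"
    by (simp add: euler_prod_def right_diff_distrib fps_X_power_mult_right_nth del: mult_Suc_right)
  thus ?case using Suc by simp
qed simp

text \<open>Uniform convergence makes the coefficients of the partial products converge; from length
  \<open>m\<close> on they are constant, so the limit is already attained.\<close>

lemma represents_qpoch_nth:
  assumes "k \<ge> 1" "represents A (\<lambda>q. qpoch (q ^ k) (q ^ k))" "m \<le> N"
  shows "fps_nth A m = fps_nth (euler_prod k N) m"
proof -
  let ?gN = "\<lambda>N q. \<Prod>n<N. 1 - q ^ k * (q ^ k) ^ n :: complex"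
  have "(\<lambda>N. (deriv ^^ m) (?gN N) 0 / fact m) \<longlonglongrightarrow> (deriv ^^ m) (\<lambda>q. qpoch (q ^ k) (q ^ k)) 0 / fact m"
  proof (intro tendsto_intros higher_deriv_complex_uniform_limit)
    show "uniform_limit (ball 0 (1/2)) ?gN (\<lambda>q. qpoch (q ^ k) (q ^ k)) sequentially"
      by (rule uniform_limit_on_subset[OF qpoch_uniform_limit[of "1/2"]]) (use assms in auto)
  qed (auto intro!: holomorphic_intros always_eventually)
  hence "(\<lambda>N. of_int (fps_nth (euler_prod k N) m)) \<longlonglongrightarrow> complex_of_int (fps_nth A m)"
    unfolding represents_nth[OF assms(2)] represents_nth[OF represents_euler_prod] .
  hence "(\<lambda>j. of_int (fps_nth (euler_prod k (N + j)) m)) \<longlonglongrightarrow> complex_of_int (fps_nth A m)"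
    using LIMSEQ_ignore_initial_segment[of _ _ N] by (simp add: add.commute)
  hence "(\<lambda>j. complex_of_int (fps_nth (euler_prod k N) m)) \<longlonglongrightarrow> complex_of_int (fps_nth A m)"
    unfolding euler_prod_nth_stable[OF assms(1,3)] .
  from LIMSEQ_unique[OF tendsto_const this] show ?thesis by simp
qed

text \<open>Up to index \<open>n\<close>, the coefficients of \<open>A\<close> and its powers agree
  with those of the partial product of length \<open>n\<close>, for which the congruence is
  known.\<close>

lemma represents_qpoch_frobenius:
  assumes k: "k \<ge> 1" and A: "represents A (\<lambda>q. qpoch (q ^ k) (q ^ k))"
  shows "fps_cong 5 (A ^ 5) (dilate5 A)"
  unfolding fps_cong_def
proof
  fix n
  define P where "P = euler_prod k n"
  have eq: "fps_nth A m = fps_nth P m" if "m \<le> n" for m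
    unfolding P_def by (rule represents_qpoch_nth[OF k A that])
  have pow: "fps_nth (A ^ j) m = fps_nth (P ^ j) m" if "m \<le> n" for j m
    using that
  proof (induction j arbitrary: m)
    case (Suc j)
    show ?case unfolding power_Suc fps_mult_nth
      by (intro sum.cong) (use Suc eq in auto)
  qed simp
  have "5 dvd fps_nth (P ^ 5) n - fps_nth (dilate5 P) n"
    using euler_prod_frobenius[of k n] by (simp add: fps_cong_def P_def)
  thus "5 dvd fps_nth (A ^ 5) n - fps_nth (dilate5 A) n"
    using pow[of n 5] eq[of "n div 5"] by (auto simp: dilate5_nth)
qed

lemma etaq_fps_power: "etaq_fps x y ^ n = etaq_fps (int n * x) (int n * y)"
  by (induction n) (simp_all add: etaq_fps_mult ring_distribs)

lemma etaq_fps_frobenius_add: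
  assumes "fps_cong 5 (etaq_fps (5 * i) (5 * j)) (dilate5 (etaq_fps i j))"
  assumes "fps_cong 5 (etaq_fps (5 * i') (5 * j')) (dilate5 (etaq_fps i' j'))"
  shows "fps_cong 5 (etaq_fps (5 * (i + i')) (5 * (j + j'))) (dilate5 (etaq_fps (i + i') (j + j')))"
  using fps_cong_mult[OF assms] by (simp add: etaq_fps_mult ring_distribs flip: dilate5_mult)

text \<open>Multiplying the congruence by the inverses of both sides interchanges the roles of the
  two inverses.\<close>

lemma etaq_fps_frobenius_minus:
  assumes "fps_cong 5 (etaq_fps (5 * i) (5 * j)) (dilate5 (etaq_fps i j))"
  shows "fps_cong 5 (etaq_fps (5 * (- i)) (5 * (- j))) (dilate5 (etaq_fps (- i) (- j)))"
proof -
  define A where "A = etaq_fps (- (5 * i)) (- (5 * j))"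
  define B where "B = dilate5 (etaq_fps (- i) (- j))"
  have A: "A * etaq_fps (5 * i) (5 * j) = 1" by (simp add: A_def etaq_fps_mult)
  have B: "B * dilate5 (etaq_fps i j) = 1"
    unfolding B_def dilate5_mult[symmetric] etaq_fps_mult by (simp add: dilate5_def)
  have "fps_cong 5 (A * B * etaq_fps (5 * i) (5 * j)) (A * B * dilate5 (etaq_fps i j))"
    by (rule fps_cong_mult_left[OF assms])
  also have "A * B * etaq_fps (5 * i) (5 * j) = B" using A by (simp add: mult_ac)
  also have "A * B * dilate5 (etaq_fps i j) = A" using B by (simp add: mult.assoc)
  finally have "fps_cong 5 B A" .
  from fps_cong_sym[OF this] show ?thesis by (simp add: A_def B_def)
qed

lemma etaq_fps_frobenius_basis:
  "fps_cong 5 (etaq_fps (5 * 1) (5 * 0)) (dilate5 (etaq_fps 1 0))"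
  "fps_cong 5 (etaq_fps (5 * 0) (5 * 1)) (dilate5 (etaq_fps 0 1))"
proof -
  have "represents (etaq_fps 1 0) (\<lambda>q. qpoch (q ^ 1) (q ^ 1))"
       "represents (etaq_fps 0 1) (\<lambda>q. qpoch (q ^ 2) (q ^ 2))"
    by (rule represents_cong[OF represents_etaq]; simp add: etaq_def)+
  from represents_qpoch_frobenius[OF _ this(1)] represents_qpoch_frobenius[OF _ this(2)]
  show "fps_cong 5 (etaq_fps (5 * 1) (5 * 0)) (dilate5 (etaq_fps 1 0))"
       "fps_cong 5 (etaq_fps (5 * 0) (5 * 1)) (dilate5 (etaq_fps 0 1))"
    by (simp_all add: etaq_fps_power)
qed

lemma etaq_fps_frobenius:
  "fps_cong 5 (etaq_fps 5 5) (dilate5 (etaq_fps 1 1))"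
  "fps_cong 5 (etaq_fps 5 (-5)) (dilate5 (etaq_fps 1 (-1)))"
  using etaq_fps_frobenius_add[OF etaq_fps_frobenius_basis]
        etaq_fps_frobenius_add[OF etaq_fps_frobenius_basis(1)
          etaq_fps_frobenius_minus[OF etaq_fps_frobenius_basis(2)]]
  by simp_all

text \<open>
  If \<open>u \<equiv> v (mod 5)\<close>, then \<open>v\<^sup>2 \<equiv> 2uv - u\<^sup>2 (mod 25)\<close>; with \<open>v\<close> a series in \<open>q\<^sup>5\<close> this
  trades a denominator for a numerator.
\<close>

lemma section5_mod25:
  assumes m: "m < 5" and fr: "fps_cong 5 (etaq_fps (5 * i) (5 * j)) (dilate5 (etaq_fps i j))"
  shows "fps_cong 25 (etaq_fps (2 * i) (2 * j) * section5 m A)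
           (2 * etaq_fps i j * section5 m (etaq_fps (5 * i) (5 * j) * A) - section5 m (etaq_fps (10 * i) (10 * j) * A))"
proof -
  define u where "u = etaq_fps (5 * i) (5 * j)"
  define v where "v = dilate5 (etaq_fps i j)"
  obtain C where C: "u - v = fps_const 5 * C"
    using fr unfolding fps_cong_iff u_def v_def by blast
  have "v * v * A - (2 * (v * (u * A)) - u * u * A) = (u - v) * (u - v) * A"
    by (simp add: algebra_simps)
  also have "\<dots> = (fps_const 5 * fps_const 5) * (C * C * A)"
    unfolding C by (simp only: mult_ac)
  finally have "fps_cong 25 (v * v * A) (2 * (v * (u * A)) - u * u * A)"
    unfolding fps_cong_iff by auto
  from fps_cong_section5[OF this, of m]
  have cong: "fps_cong 25 (section5 m (v * v * A)) (2 * section5 m (v * (u * A)) - section5 m (u * u * A))"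
    by (simp add: section5_diff section5_const_mult numeral_fps_const)
  have vv: "v * v = dilate5 (etaq_fps (2 * i) (2 * j))"
    by (simp add: v_def etaq_fps_mult flip: dilate5_mult)
  have uu: "u * u = etaq_fps (10 * i) (10 * j)"
    by (simp add: u_def etaq_fps_mult)
  have sec: "section5 m (v * B) = etaq_fps i j * section5 m B" for B
    unfolding v_def by (rule section5_dilate5_mult[OF m])
  show ?thesis
    using cong unfolding vv uu sec section5_dilate5_mult[OF m] by (simp add: mult.assoc u_def)
qed

section \<open>The Hecke operator at five\<close>

text \<open>The section differs from the Hecke image only by a term with the factor
  \<open>5 ^ (k - 1)\<close>, so modulo that power it is a form with known orders at both
  cusps.\<close>

lemma section5_etaq_cusp_pair:
  fixes m m' s s' k :: nat
  assumes k: "k \<ge> 1" and xy: "x + y = 2 * int k"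
  assumes N: "x + 2 * y = int m + 5 * int s" "y + 2 * x = int m' + 5 * int s'"
  assumes m: "m < 5" "m' < 5"
  obtains P p p' where "represents P p" "cusp_pair k (5 * int m + int s) (5 * int m' + int s') p p'"
    "fps_cong (5 ^ (k - 1)) (section5 m (etaq_fps x y)) P"
proof -
  obtain u where u: "represents (section5 m (etaq_fps x y)) u"
    "\<And>\<tau>. Im \<tau> > 0 \<Longrightarrow> (\<Sum>b\<in>{-2..2::int}. qexp (of_int b * (- of_nat m / 5)) * etaq x y (qexp ((\<tau> + of_int b) / 5))) =
            5 * qexp (of_nat m * \<tau> / 5) * u (qexp \<tau>)"
    using represents_section5[OF represents_etaq m(1)] by blast
  obtain u' where u': "represents (section5 m' (etaq_fps y x)) u'"
    "\<And>\<tau>. Im \<tau> > 0 \<Longrightarrow> (\<Sum>b\<in>{-2..2::int}. qexp (of_int b * (- of_nat m' / 5)) * etaq y x (qexp ((\<tau> + of_int b) / 5))) =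
            5 * qexp (of_nat m' * \<tau> / 5) * u' (qexp \<tau>)"
    using represents_section5[OF represents_etaq m(2)] by blast
  obtain p' where p': "cusp_pair k (5 * int m + int s) (5 * int m' + int s')
    (\<lambda>q. u q + parity_sign x * 5 ^ (k - 1) * q ^ s * etaq x y (q ^ 5)) p'"
    using hecke_cusp_pair[OF k xy N represents_holomorphic[OF u(1)] represents_holomorphic[OF u'(1)] u(2) u'(2)]
    by blast
  define \<epsilon> :: int where "\<epsilon> = (if even x then 1 else -1)"
  define D where "D = fps_const (\<epsilon> * 5 ^ (k - 1)) * (fps_X ^ s * dilate5 (etaq_fps x y))"
  have "represents D (\<lambda>q. of_int (\<epsilon> * 5 ^ (k - 1)) * (q ^ s * etaq x y (q ^ 5)))"
    unfolding D_def
    by (intro represents_mult represents_const represents_X_power represents_dilate5 represents_etaq)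
  from represents_add[OF u(1) this]
  have "represents (section5 m (etaq_fps x y) + D)
          (\<lambda>q. u q + parity_sign x * 5 ^ (k - 1) * q ^ s * etaq x y (q ^ 5))"
    by (rule represents_cong) (simp add: parity_sign_def \<epsilon>_def)
  moreover have "fps_cong (5 ^ (k - 1)) (section5 m (etaq_fps x y)) (section5 m (etaq_fps x y) + D)"
    by (simp add: fps_cong_def D_def)
  ultimately show ?thesis using that p' by blast
qed

lemma section5_etaq_zero:
  fixes m m' s s' k :: nat
  assumes k: "k \<ge> 1" and xy: "x + y = 2 * int k"
  assumes N: "x + 2 * y = int m + 5 * int s" "y + 2 * x = int m' + 5 * int s'"
  assumes m: "m < 5" "m' < 5"
  assumes M: "5 * int m + int s + (5 * int m' + int s') = 6 * int k + 24"
  shows "fps_cong (5 ^ (k - 1)) (section5 m (etaq_fps x y)) 0"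
proof -
  obtain P p p' where P: "represents P p" "cusp_pair k (5 * int m + int s) (5 * int m' + int s') p p'"
    "fps_cong (5 ^ (k - 1)) (section5 m (etaq_fps x y)) P"
    using section5_etaq_cusp_pair[OF k xy N m] by blast
  have "represents P (\<lambda>q. of_int 0)"
    by (rule represents_cong[OF P(1)]) (simp add: cusp_pair_zero[OF P(2) M])
  hence "P = 0"
    using represents_unique[OF _ represents_const[of 0]] by simp
  thus ?thesis using P(3) by simp
qed

text \<open>The scalar is an integer because \<open>etaq_fps i j\<close> has constant coefficient 1:
  it is the constant coefficient of the integral series \<open>P\<close>.\<close>

lemma section5_etaq_dim1:
  fixes m m' s s' k :: nat
  assumes k: "k \<ge> 1" and xy: "x + y = 2 * int k"
  assumes N: "x + 2 * y = int m + 5 * int s" "y + 2 * x = int m' + 5 * int s'"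
  assumes m: "m < 5" "m' < 5"
  assumes M: "i + j = 2 * int k" "5 * int m + int s = i + 2 * j" "5 * int m' + int s' = j + 2 * i"
  obtains c where "fps_cong (5 ^ (k - 1)) (section5 m (etaq_fps x y)) (fps_const c * etaq_fps i j)"
proof -
  obtain P p p' where P: "represents P p" "cusp_pair k (5 * int m + int s) (5 * int m' + int s') p p'"
    "fps_cong (5 ^ (k - 1)) (section5 m (etaq_fps x y)) P"
    using section5_etaq_cusp_pair[OF k xy N m] by blast
  obtain c where c: "\<And>q. norm q < 1 \<Longrightarrow> p q = c * etaq i j q"
    using cusp_pair_unique[OF P(2) M] by metis
  have c_eq: "c = of_int (fps_nth P 0)"
    using c[of 0] represents_at_0[OF P(1)] by simp
  have "P = fps_const (fps_nth P 0) * etaq_fps i j"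
  proof (rule represents_unique[OF P(1)])
    show "represents (fps_const (fps_nth P 0) * etaq_fps i j) p"
      by (rule represents_cong[OF represents_mult[OF represents_const represents_etaq]])
         (use c in \<open>simp add: c_eq\<close>)
  qed
  thus ?thesis using that[of "fps_nth P 0"] P(3) by simp
qed

lemma section5_etaq_dim2:
  fixes m m' s s' k :: nat
  assumes k: "k \<ge> 1" and xy: "x + y = 2 * int k"
  assumes N: "x + 2 * y = int m + 5 * int s" "y + 2 * x = int m' + 5 * int s'"
  assumes m: "m < 5" "m' < 5"
  assumes M: "i + j = 2 * int k" "5 * int m + int s = i + 2 * j" "5 * int m' + int s' + 24 = j + 2 * i"
  obtains c d where "fps_cong (5 ^ (k - 1)) (section5 m (etaq_fps x y))
    (fps_const c * etaq_fps i j + fps_const d * (fps_X * etaq_fps (i - 24) (j + 24)))"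
proof -
  obtain P p p' where P: "represents P p" "cusp_pair k (5 * int m + int s) (5 * int m' + int s') p p'"
    "fps_cong (5 ^ (k - 1)) (section5 m (etaq_fps x y)) P"
    using section5_etaq_cusp_pair[OF k xy N m] by blast
  obtain a b where ab: "\<And>q. norm q < 1 \<Longrightarrow> p q = a * etaq i j q + b * q * etaq (i - 24) (j + 24) q"
    using cusp_pair_dim2[OF P(2) M] by metis
  have a_eq: "a = of_int (fps_nth P 0)"
    using ab[of 0] represents_at_0[OF P(1)] by simp
  \<comment> \<open>Dividing by the second basis quotient leaves the monomial \<open>b * q\<close>;
    as \<open>D\<close> is integral, so is \<open>b\<close>.\<close>
  define D where "D = (P - fps_const (fps_nth P 0) * etaq_fps i j) * etaq_fps (24 - i) (- 24 - j)"
  have "represents D (\<lambda>q. (p q - a * etaq i j q) * etaq (24 - i) (- 24 - j) q)"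
    unfolding D_def a_eq
    by (intro represents_mult represents_diff represents_const represents_etaq P(1))
  hence D: "represents D (\<lambda>q. b * q)"
  proof (rule represents_cong)
    fix q :: complex assume q: "norm q < 1"
    have "etaq (i - 24) (j + 24) q * etaq (24 - i) (- 24 - j) q = 1"
      by (subst etaq_add[OF q, symmetric]) (simp add: etaq_def)
    thus "(p q - a * etaq i j q) * etaq (24 - i) (- 24 - j) q = b * q"
      by (simp add: ab[OF q])
  qed
  have b: "complex_of_int (fps_nth D 1) = b"
    using represents_nth[OF D, of 1] by simp
  have "represents (fps_const (fps_nth D 1) * fps_X ^ 1) (\<lambda>q. of_int (fps_nth D 1) * q ^ 1)"
    by (intro represents_mult represents_const represents_X_power)
  hence "represents (fps_const (fps_nth D 1) * fps_X) (\<lambda>q. b * q)"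
    by (simp only: b power_one_right)
  hence D_eq: "D = fps_const (fps_nth D 1) * fps_X"
    by (rule represents_unique[OF D])
  have "D * etaq_fps (i - 24) (j + 24) = P - fps_const (fps_nth P 0) * etaq_fps i j"
    by (simp add: D_def mult.assoc etaq_fps_mult)
  hence "P = fps_const (fps_nth P 0) * etaq_fps i j + fps_const (fps_nth D 1) * (fps_X * etaq_fps (i - 24) (j + 24))"
    by (subst (asm) D_eq) (simp add: algebra_simps)
  thus ?thesis using that[of "fps_nth P 0" "fps_nth D 1"] P(3) by simp
qed

section \<open>Three applications of the section operator\<close>

lemma section5_cubic:
  "fps_cong 25 (section5 3 (section5 4 (section5 4 (etaq_fps (-3) 1)))) 0"
proof -
  let ?E = etaq_fps
  \<comment> \<open>Adding (5, 5) to the exponents (-3, 1) once and twice gives (2, 6) and (7, 11).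
    The instances list the weight, the exponents, quotient data of the two orders modulo 5, and
    target exponents: here 14 = 4 + 5 * 2 and 10 = 0 + 5 * 2, with image orders 22 and 2.\<close>
  obtain a where a: "fps_cong 125 (section5 4 (?E 2 6)) (fps_const a * ?E (-6) 14)"
    by (rule section5_etaq_dim1[of 4 2 6 4 2 0 2 "-6" 14]) simp_all
  obtain b c where bc: "fps_cong (5 ^ 8) (section5 4 (?E 7 11)) (fps_const b * ?E 11 7 + fps_const c * (fps_X * ?E (-13) 31))"
    by (rule section5_etaq_dim2[of 9 7 11 4 5 0 5 11 7]) simp_all
  \<comment> \<open>These arise from (-7, 13) by adding (5, -5) once and twice. The image orders sum
    to 42 = 6 * 3 + 24, so the forms vanish, and weight 3 gives precisely the modulus 25.\<close>
  have z1: "fps_cong 25 (section5 4 (?E (-2) 8)) 0"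
    using section5_etaq_zero[of 3 "-2" 8 4 2 4 0] by simp
  have z2: "fps_cong 25 (section5 4 (?E 3 3)) 0"
    using section5_etaq_zero[of 3 3 3 4 1 4 1] by simp
  have z3: "fps_cong 5 (section5 3 (?E 0 4)) 0"
    using section5_etaq_zero[of 2 0 4 3 1 4 0] by simp
  obtain d where d: "fps_cong (5 ^ 6) (section5 4 (?E 9 5)) (fps_const d * ?E 5 9)"
    by (rule section5_etaq_dim1[of 7 9 5 4 3 3 4 5 9]) simp_all
  \<comment> \<open>Adding (5, -5) once and twice to (-15, 29) gives the exponents of this and the
    following instance.\<close>
  obtain e where e: "fps_cong (5 ^ 6) (section5 3 (?E (-10) 24)) (fps_const e * ?E 6 8)"
    by (rule section5_etaq_dim1[of 7 "-10" 24 3 7 4 0 6 8]) simp_all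
  obtain f where f: "fps_cong (5 ^ 6) (section5 3 (?E (-5) 19)) (fps_const f * ?E 7 7)"
    by (rule section5_etaq_dim1[of 7 "-5" 19 3 6 4 1 7 7]) simp_all
  have c25: "fps_cong 25 A B" if "fps_cong (5 ^ 8) A B \<or> fps_cong (5 ^ 6) A B \<or> fps_cong 125 A B" for A B
    using that by (auto elim: fps_cong_dvd)
  have 25: "fps_cong 25 (section5 4 (?E 2 6)) (fps_const a * ?E (-6) 14)"
    "fps_cong 25 (section5 4 (?E 7 11)) (fps_const b * ?E 11 7 + fps_const c * (fps_X * ?E (-13) 31))"
    "fps_cong 25 (section5 4 (?E 9 5)) (fps_const d * ?E 5 9)"
    "fps_cong 25 (section5 3 (?E (-10) 24)) (fps_const e * ?E 6 8)"
    "fps_cong 25 (section5 3 (?E (-5) 19)) (fps_const f * ?E 7 7)"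
    using a bc d e f c25 by blast+

  define S where "S = section5 4 (?E (-3) 1)"
  have S: "fps_cong 25 S (fps_const (2 * a) * ?E (-7) 13 - (fps_const b * ?E 9 5 + fps_const c * (fps_X * ?E (-15) 29)))"
  proof -
    have "fps_cong 25 (?E 2 2 * S) (2 * ?E 1 1 * section5 4 (?E 2 6) - section5 4 (?E 7 11))"
      using section5_mod25[of 4 1 1 "?E (-3) 1"] etaq_fps_frobenius(1) by (simp add: S_def etaq_fps_mult)
    also have "fps_cong 25 \<dots> (2 * ?E 1 1 * (fps_const a * ?E (-6) 14) -
        (fps_const b * ?E 11 7 + fps_const c * (fps_X * ?E (-13) 31)))"
      by (intro fps_cong_diff fps_cong_mult_left 25)
    finally have "fps_cong 25 (?E (-2) (-2) * (?E 2 2 * S)) (?E (-2) (-2) * (2 * ?E 1 1 * (fps_const a * ?E (-6) 14) -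
        (fps_const b * ?E 11 7 + fps_const c * (fps_X * ?E (-13) 31))))"
      by (rule fps_cong_mult_left)
    also have "?E (-2) (-2) * (?E 2 2 * S) = S"
      by (simp add: etaq_fps_mult_left)
    also have "?E (-2) (-2) * (2 * ?E 1 1 * (fps_const a * ?E (-6) 14) -
        (fps_const b * ?E 11 7 + fps_const c * (fps_X * ?E (-13) 31))) =
        2 * fps_const a * (?E (-2) (-2) * (?E 1 1 * ?E (-6) 14)) -
        (fps_const b * (?E (-2) (-2) * ?E 11 7) + fps_const c * (fps_X * (?E (-2) (-2) * ?E (-13) 31)))"
      by (simp only: ring_distribs mult_ac)
    also have "\<dots> = fps_const (2 * a) * ?E (-7) 13 - (fps_const b * ?E 9 5 + fps_const c * (fps_X * ?E (-15) 29))"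
      by (simp add: etaq_fps_mult numeral_fps_const)
    finally show ?thesis .
  qed

  have "fps_cong 25 (?E 2 (-2) * section5 4 (?E (-7) 13)) (2 * ?E 1 (-1) * section5 4 (?E (-2) 8) - section5 4 (?E 3 3))"
    using section5_mod25[of 4 1 "-1" "?E (-7) 13"] etaq_fps_frobenius(2) by (simp add: etaq_fps_mult)
  also have "fps_cong 25 \<dots> (2 * ?E 1 (-1) * 0 - 0)"
    by (intro fps_cong_diff fps_cong_mult_left z1 z2)
  finally have "fps_cong 25 (?E (-2) 2 * (?E 2 (-2) * section5 4 (?E (-7) 13))) (?E (-2) 2 * 0)"
    by (intro fps_cong_mult_left) simp
  hence Y: "fps_cong 25 (section5 4 (?E (-7) 13)) 0"
    by (simp add: etaq_fps_mult_left)

  have "fps_cong 25 (?E 2 (-2) * section5 3 (?E (-15) 29)) (2 * ?E 1 (-1) * section5 3 (?E (-10) 24) - section5 3 (?E (-5) 19))"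
    using section5_mod25[of 3 1 "-1" "?E (-15) 29"] etaq_fps_frobenius(2) by (simp add: etaq_fps_mult)
  also have "fps_cong 25 \<dots> (2 * ?E 1 (-1) * (fps_const e * ?E 6 8) - fps_const f * ?E 7 7)"
    by (intro fps_cong_diff fps_cong_mult_left 25)
  also have "\<dots> = fps_const (2 * e - f) * ?E 7 7"
  proof -
    have "2 * ?E 1 (-1) * (fps_const e * ?E 6 8) - fps_const f * ?E 7 7 =
          2 * fps_const e * (?E 1 (-1) * ?E 6 8) - fps_const f * ?E 7 7"
      by (simp only: mult_ac)
    also have "\<dots> = fps_const (2 * e - f) * ?E 7 7"
      by (simp add: etaq_fps_mult numeral_fps_const left_diff_distrib flip: fps_const_sub)
    finally show ?thesis .
  qed
  finally have "fps_cong 25 (?E (-2) 2 * (?E 2 (-2) * section5 3 (?E (-15) 29))) (?E (-2) 2 * (fps_const (2 * e - f) * ?E 7 7))"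
    by (rule fps_cong_mult_left)
  hence Z: "fps_cong 25 (section5 3 (?E (-15) 29)) (fps_const (2 * e - f) * ?E 5 9)"
    by (simp add: etaq_fps_mult_left etaq_fps_mult mult.left_commute)

  define \<kappa> where "\<kappa> = - (b * d + c * (2 * e - f))"
  \<comment> \<open>The factor \<open>fps_X\<close> in the last term of \<open>S\<close> lowers the
    residue from 4 to 3.\<close>
  have "fps_cong 25 (section5 4 S) (fps_const (2 * a) * section5 4 (?E (-7) 13) -
          (fps_const b * section5 4 (?E 9 5) + fps_const c * section5 3 (?E (-15) 29)))"
    using fps_cong_section5[OF S, of 4] section5_X_mult[of 3]
    by (simp add: section5_add section5_diff section5_const_mult)
  also have "fps_cong 25 \<dots> (fps_const (2 * a) * 0 -
          (fps_const b * (fps_const d * ?E 5 9) + fps_const c * (fps_const (2 * e - f) * ?E 5 9)))"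
    by (intro fps_cong_diff fps_cong_add fps_cong_mult_left 25 Y Z)
  also have "\<dots> = fps_const \<kappa> * ?E 5 9"
    by (simp add: fps_eq_iff \<kappa>_def algebra_simps)
  finally have SS: "fps_cong 25 (section5 4 S) (fps_const \<kappa> * ?E 5 9)" .

  \<comment> \<open>Modulo 5 a single multiplication by \<open>?E 5 5\<close> suffices, which leaves
    only the term in \<open>?E (-7) 13\<close>; its section vanishes by \<open>Y\<close>.\<close>
  have "fps_cong 5 (section5 4 S) 0"
  proof -
    have "fps_cong 5 (?E 1 1 * S) (section5 4 (dilate5 (?E 1 1) * ?E (-3) 1))"
      by (simp add: section5_dilate5_mult S_def)
    also have "fps_cong 5 \<dots> (section5 4 (?E 5 5 * ?E (-3) 1))"
      using fps_cong_mult_left[OF fps_cong_sym[OF etaq_fps_frobenius(1)], of "?E (-3) 1"]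
      by (intro fps_cong_section5) (simp only: mult.commute)
    also have "?E 5 5 * ?E (-3) 1 = ?E 2 6"
      by (simp add: etaq_fps_mult)
    also have "fps_cong 5 (section5 4 (?E 2 6)) (fps_const a * ?E (-6) 14)"
      by (rule fps_cong_dvd[OF a]) simp
    finally have "fps_cong 5 (?E (-1) (-1) * (?E 1 1 * S)) (?E (-1) (-1) * (fps_const a * ?E (-6) 14))"
      by (rule fps_cong_mult_left)
    hence "fps_cong 5 S (fps_const a * ?E (-7) 13)"
      by (simp add: etaq_fps_mult_left etaq_fps_mult mult.left_commute)
    from fps_cong_section5[OF this, of 4]
    have "fps_cong 5 (section5 4 S) (fps_const a * section5 4 (?E (-7) 13))"
      by (simp add: section5_const_mult)
    also have "fps_cong 5 \<dots> (fps_const a * 0)"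
      by (intro fps_cong_mult_left fps_cong_dvd[OF Y]) simp
    finally show ?thesis by simp
  qed
  hence "fps_cong 5 (fps_const \<kappa> * ?E 5 9) 0"
    using fps_cong_trans[OF fps_cong_sym[OF fps_cong_dvd[OF SS, of 5]]] by simp
  \<comment> \<open>The constant coefficient of \<open>?E 5 9\<close> is 1, so index 0 isolates
    \<open>\<kappa>\<close>.\<close>
  hence "5 dvd fps_nth (fps_const \<kappa> * ?E 5 9) 0 - fps_nth 0 0"
    unfolding fps_cong_def by blast
  then obtain l where l: "\<kappa> = 5 * l" by auto

  \<comment> \<open>The second factor 5 comes from splitting (5, 9) as (5, 5) + (0, 4): the first
    part is a series in q^5 modulo 5, the second has vanishing section by \<open>z3\<close>.\<close>
  have "fps_cong 5 (section5 3 (?E 5 5 * ?E 0 4)) (section5 3 (dilate5 (?E 1 1) * ?E 0 4))"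
    using fps_cong_mult_left[OF etaq_fps_frobenius(1), of "?E 0 4"]
    by (intro fps_cong_section5) (simp only: mult.commute)
  also have "\<dots> = ?E 1 1 * section5 3 (?E 0 4)"
    by (simp add: section5_dilate5_mult)
  also have "fps_cong 5 \<dots> (?E 1 1 * 0)"
    by (rule fps_cong_mult_left[OF z3])
  finally have "fps_cong 5 (section5 3 (?E 5 9)) 0"
    by (simp add: etaq_fps_mult)
  hence "5 dvd fps_nth (section5 3 (?E 5 9)) n" for n
    by (simp only: fps_cong_def fps_zero_nth diff_zero)
  hence "5 * 5 dvd \<kappa> * fps_nth (section5 3 (?E 5 9)) n" for n
    unfolding l by (intro mult_dvd_mono) auto
  hence "fps_cong 25 (fps_const \<kappa> * section5 3 (?E 5 9)) 0"
    by (simp add: fps_cong_def)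
  moreover have "fps_cong 25 (section5 3 (section5 4 S)) (fps_const \<kappa> * section5 3 (?E 5 9))"
    using fps_cong_section5[OF SS, of 3] by (simp add: section5_const_mult)
  ultimately show ?thesis unfolding S_def by (rule fps_cong_trans[rotated])
qed

theorem theorem2:
  fixes c :: "nat \<Rightarrow> int"
  assumes "\<And>q :: complex. norm q < 1 \<Longrightarrow>
             (\<lambda>n. of_int (c n) * q ^ n) sums (qpoch (q ^ 2) (q ^ 2) / qpoch q q ^ 3)"
  shows "\<forall>n :: nat. [c (125 * n + 99) = 0] (mod 25)"
proof
  fix n
  have "represents (Abs_fps c) (\<lambda>q. qpoch (q ^ 2) (q ^ 2) / qpoch q q ^ 3)"
    using assms by (simp add: represents_def)
  moreover have "represents (etaq_fps (-3) 1) (\<lambda>q. qpoch (q ^ 2) (q ^ 2) / qpoch q q ^ 3)"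
    by (rule represents_cong[OF represents_etaq]) (simp add: etaq_def power_int_minus divide_inverse mult.commute)
  ultimately have c: "etaq_fps (-3) 1 = Abs_fps c"
    by (metis represents_unique)
  have "25 dvd fps_nth (section5 3 (section5 4 (section5 4 (etaq_fps (-3) 1)))) n - fps_nth 0 n"
    using section5_cubic unfolding fps_cong_def by blast
  \<comment> \<open>Innermost last, the indices compose to 5 (5 (5 n + 3) + 4) + 4 = 125 n +
    99.\<close>
  also have "fps_nth (section5 3 (section5 4 (section5 4 (etaq_fps (-3) 1)))) n = c (125 * n + 99)"
    by (simp add: c algebra_simps)
  finally show "[c (125 * n + 99) = 0] (mod 25)"
    by (simp add: cong_0_iff)
qed

end
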